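(* Let $d\in\mathbb N$, $\omega(n)=(1+|n|)^s$, $n\in\mathbb Z^d$, with $s>(d+1)^2$. Let $\Phi=\{\varphi_k\}_{k\in\mathbb Z^d}$ be a countable collection of continuous functions on $\mathbb R^d$ belonging to $W^1_\omega$, such that for every $q\in\{0\}\cup[1,\infty]$ there are constants $m_q,M_q>0$ with $$m_q\|c\|_{\ell^q}\le\Big\|\sum_{k\in\mathbb Z^d}c_k\varphi_k\Big\|_{L^q}\le M_q\|c\|_{\ell^q}\quad\text{for all }c\in\ell^q(\mathbb Z^d),$$ and let $\mu=\{\mu_j\}_{j\in\mathbb Z^d}$ be a countable collection of finite complex Borel measures on $\mathbb R^d$ that is a $(\Phi,p)$-sampler for every $p\in[1,\infty]$. Assume that the sampling operator $\mathbb A^\Phi_\mu$ is bounded on $\mathfrak c_0(\mathbb Z^d)$ and on all $\ell^p(\mathbb Z^d)$, $p\in[1,\infty]$, that $\mathbb A^\Phi_\mu$ is bounded below in $\ell^p$ for some $p\in\{0\}\cup[1,\infty]$, and that $\mathbb A^\Phi_\mu\in\Sigma^\omega_\alpha$ for some real $\alpha\ne0$. Then $\mu$ is a stable sampler on $V^q(\Phi)$ for every $q\in\{0\}\cup[1,\infty]$.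
   Context: For $n\in\mathbb Z^d$, $|n|=\max_{1\le k\le d}|n_k|$. All sequences are complex scalar. Convention for index $0$: $\ell^0$ means $\mathfrak c_0(\mathbb Z^d)$ (sequences tending to $0$ at infinity) with the sup-norm, and $L^0$-norm means the $L^\infty$-norm. $W^1_\omega$ is the space of measurable functions $\varphi$ on $\mathbb R^d$ with $\|\varphi\|_{W^1_\omega}=\sum_{k\in\mathbb Z^d}\omega(k)\operatorname{ess\,sup}\{|\varphi(x+k)|:x\in[0,1]^d\}<\infty$. $V^p(\Phi)=\{\sum_{k\in\mathbb Z^d}c_k\varphi_k\}$, where $c=(c_k)$ ranges over $\ell^p(\mathbb Z^d)$ for $p\in[1,\infty]$ and over $\mathfrak c_0(\mathbb Z^d)$ for $p=0$. The $\mu$-sample of $f$ is the sequence $f(\mu)=(\int f\,d\mu_j)_{j\in\mathbb Z^d}$. $\mu$ is a $(\Phi,p)$-sampler if $f(\mu)\in\ell^p$ and $\|f(\mu)\|_{\ell^p}\le C\|f\|_{L^p}$ for some constant $C$ and all $f\in V^p(\Phi)$. The sampling operator is given by the matrix $(\mathbb A^\Phi_\mu c)(j)=\sum_{k\in\mathbb Z^d}\int c_k\varphi_k\,d\mu_j$. The sampler $\mu$ is stable on $V^p(\Phi)$ if $\mathbb A^\Phi_\mu:\ell^p(\mathbb Z^d)\to\ell^p(\mathbb Z^d)$ is bounded and bounded below in $\ell^p$. An operator $\mathbb A$ is bounded below in $\ell^p$ if there is $\kappa_p>0$ with $\|\mathbb Ac\|_p\ge\kappa_p\|c\|_p$ for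 all $c\in\ell^p(\mathbb Z^d)$. For a scalar matrix $\mathbb A=(a_{mn})_{m,n\in\mathbb Z^d}$ let $\|\mathbb A\|_{\sup}=\sup_{m,n}|a_{mn}|$. For $\alpha\neq0$ and $j\in\mathbb Z^d$ the $j$-th $\alpha$-slant is $A_j=(a^{(j)}_{mn})$, $a^{(j)}_{mn}=a_{mn}\prod_{k=1}^d\chi_{[j_k,j_k+1)}(\alpha m_k-n_k)$. With $K=\lceil|\alpha|^{-1}\rceil^d$, $\Sigma^\omega_\alpha$ is the class of matrices with $K\sum_{j\in\mathbb Z^d}\|A_j\|_{\sup}\omega(j)<\infty$. *)

theory Defs
  imports "HOL-Analysis.Analysis" "HOL-Probability.Essential_Supremum"
begin

subsection \<open>Sequence and function spaces\<close>

text \<open>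
  The lattice and the Euclidean space of dimension \<open>d = CARD('d)\<close> are \<^typ>\<open>int ^ 'd\<close> and
  \<^typ>\<open>real ^ 'd\<close>. By convention the exponent 0 stands for the space of null sequences (for
  sequences) and for the sup-norm (for norms).
\<close>

definition exponents :: "ennreal set"
  where "exponents = {0} \<union> {1..\<infinity>}"

definition lp_space :: "ennreal \<Rightarrow> (int ^ 'd \<Rightarrow> complex) set"
  where "lp_space p =
    (if p = 0 then {c. (c \<longlongrightarrow> 0) cofinite}
     else if p = \<infinity> then {c. bounded (range c)}
     else {c. (\<lambda>n. norm (c n) powr enn2real p) summable_on UNIV})"

definition lp_norm :: "ennreal \<Rightarrow> (int ^ 'd \<Rightarrow> complex) \<Rightarrow> real"
  where "lp_norm p c =
    (if p = 0 \<or> p = \<infinity> then (SUP n. norm (c n))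
     else (\<Sum>\<^sub>\<infinity>n. norm (c n) powr enn2real p) powr (1 / enn2real p))"

definition Lp_space :: "ennreal \<Rightarrow> (real ^ 'd \<Rightarrow> complex) set"
  where "Lp_space p =
    {f \<in> borel_measurable lborel.
       if p = 0 \<or> p = \<infinity> then esssup lborel (\<lambda>x. ennreal (norm (f x))) < \<infinity>
       else integrable lborel (\<lambda>x. norm (f x) powr enn2real p)}"

definition Lp_norm :: "ennreal \<Rightarrow> (real ^ 'd \<Rightarrow> complex) \<Rightarrow> real"
  where "Lp_norm p f =
    (if p = 0 \<or> p = \<infinity> then enn2real (esssup lborel (\<lambda>x. ennreal (norm (f x))))
     else (LINT x|lborel. norm (f x) powr enn2real p) powr (1 / enn2real p))"

definition lattice_norm :: "int ^ 'd \<Rightarrow> int"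
  where "lattice_norm n = Max (range (\<lambda>k. \<bar>n $ k\<bar>))"

definition poly_weight :: "real \<Rightarrow> int ^ 'd \<Rightarrow> real"
  where "poly_weight s n = (1 + real_of_int (lattice_norm n)) powr s"

definition W1_norm :: "(int ^ 'd \<Rightarrow> real) \<Rightarrow> (real ^ 'd \<Rightarrow> complex) \<Rightarrow> ennreal"
  where "W1_norm \<omega> f =
    (\<Sum>\<^sub>\<infinity>k. ennreal (\<omega> k) *
       esssup (restrict_space lborel (cbox 0 1))
         (\<lambda>x. ennreal (norm (f (x + (\<chi> i. real_of_int (k $ i)))))))"

definition W1_space :: "(int ^ 'd \<Rightarrow> real) \<Rightarrow> (real ^ 'd \<Rightarrow> complex) set"
  where "W1_space \<omega> = {f \<in> borel_measurable lborel. W1_norm \<omega> f < \<infinity>}"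

subsection \<open>The spaces \<open>V\<^sup>p(\<Phi>)\<close>\<close>

text \<open>
  The series is summed pointwise, because elements of \<open>V\<^sup>p(\<Phi>)\<close> are integrated against arbitrary,
  possibly singular, measures. If \<open>\<Phi>\<close> consists of continuous functions and satisfies the upper
  bound of \<open>p_stable_generator \<infinity> \<Phi>\<close> for finitely supported sequences, then
  \<open>\<Sum>\<^sub>k |\<Phi>\<^sub>k(x)| \<le> M\<^sub>\<infinity>\<close> for every \<open>x\<close>, so that the series converges absolutely at every point for
  every bounded sequence of coefficients.
\<close>

definition synthesis ::
  "(int ^ 'd \<Rightarrow> real ^ 'd \<Rightarrow> complex) \<Rightarrow> (int ^ 'd \<Rightarrow> complex) \<Rightarrow> real ^ 'd \<Rightarrow> complex"
  where "synthesis \<Phi> c = (\<lambda>x. \<Sum>\<^sub>\<infinity>k. c k * \<Phi> k x)"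

definition V_space ::
  "ennreal \<Rightarrow> (int ^ 'd \<Rightarrow> real ^ 'd \<Rightarrow> complex) \<Rightarrow> (real ^ 'd \<Rightarrow> complex) set"
  where "V_space p \<Phi> = synthesis \<Phi> ` lp_space p"

definition p_stable_generator ::
  "ennreal \<Rightarrow> (int ^ 'd \<Rightarrow> real ^ 'd \<Rightarrow> complex) \<Rightarrow> bool"
  where "p_stable_generator p \<Phi> \<longleftrightarrow>
    (\<exists>m M. 0 < m \<and> 0 < M \<and>
      (\<forall>c\<in>lp_space p. synthesis \<Phi> c \<in> Lp_space p \<and>
         m * lp_norm p c \<le> Lp_norm p (synthesis \<Phi> c) \<and>
         Lp_norm p (synthesis \<Phi> c) \<le> M * lp_norm p c))"

subsection \<open>Complex Borel measures\<close>

text \<open>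
  A complex measure is a countably additive complex-valued set function on the Borel sets (and is
  then automatically finite). Its values on other sets are irrelevant.
\<close>

definition complex_borel_measure :: "((real ^ 'd) set \<Rightarrow> complex) \<Rightarrow> bool"
  where "complex_borel_measure \<nu> \<longleftrightarrow>
    (\<forall>A :: nat \<Rightarrow> (real ^ 'd) set. range A \<subseteq> sets borel \<longrightarrow> disjoint_family A \<longrightarrow>
       (\<lambda>i. \<nu> (A i)) sums \<nu> (\<Union>i. A i))"

text \<open>
  The positive variation \<open>\<sigma>\<^sup>+(E) = sup {\<sigma>(A) | A \<subseteq> E}\<close> of a finite signed Borel measure; the negative
  variation is the positive variation of \<open>-\<sigma>\<close>. Note that \<^const>\<open>ennreal\<close> sends negative reals to 0,
  which does not affect the supremum as \<open>\<sigma>({}) = 0\<close>.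
\<close>

definition pos_variation :: "((real ^ 'd) set \<Rightarrow> real) \<Rightarrow> (real ^ 'd) measure"
  where "pos_variation \<sigma> =
    measure_of UNIV (sets borel) (\<lambda>E. SUP A\<in>{A \<in> sets borel. A \<subseteq> E}. ennreal (\<sigma> A))"

text \<open>The integral is defined through the Jordan decompositions of the real and imaginary parts.\<close>

definition complex_measure_integral ::
  "((real ^ 'd) set \<Rightarrow> complex) \<Rightarrow> (real ^ 'd \<Rightarrow> complex) \<Rightarrow> complex"
  where "complex_measure_integral \<nu> f =
    (LINT x|pos_variation (\<lambda>A. Re (\<nu> A)). f x) - (LINT x|pos_variation (\<lambda>A. - Re (\<nu> A)). f x) +
    \<i> * ((LINT x|pos_variation (\<lambda>A. Im (\<nu> A)). f x) - (LINT x|pos_variation (\<lambda>A. - Im (\<nu> A)). f x))"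

subsection \<open>Matrices over the lattice\<close>

definition mat_app ::
  "(int ^ 'd \<Rightarrow> int ^ 'd \<Rightarrow> complex) \<Rightarrow> (int ^ 'd \<Rightarrow> complex) \<Rightarrow> int ^ 'd \<Rightarrow> complex"
  where "mat_app A c = (\<lambda>m. \<Sum>\<^sub>\<infinity>n. A m n * c n)"

definition lp_bounded :: "ennreal \<Rightarrow> (int ^ 'd \<Rightarrow> int ^ 'd \<Rightarrow> complex) \<Rightarrow> bool"
  where "lp_bounded p A \<longleftrightarrow>
    (\<forall>c\<in>lp_space p. (\<forall>m. (\<lambda>n. A m n * c n) summable_on UNIV) \<and> mat_app A c \<in> lp_space p) \<and>
    (\<exists>C. \<forall>c\<in>lp_space p. lp_norm p (mat_app A c) \<le> C * lp_norm p c)"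

definition lp_bounded_below :: "ennreal \<Rightarrow> (int ^ 'd \<Rightarrow> int ^ 'd \<Rightarrow> complex) \<Rightarrow> bool"
  where "lp_bounded_below p A \<longleftrightarrow>
    (\<exists>\<kappa>>0. \<forall>c\<in>lp_space p. lp_norm p (mat_app A c) \<ge> \<kappa> * lp_norm p c)"

definition mat_sup_norm :: "(int ^ 'd \<Rightarrow> int ^ 'd \<Rightarrow> complex) \<Rightarrow> ennreal"
  where "mat_sup_norm A = (SUP m. SUP n. ennreal (norm (A m n)))"

definition slant ::
  "real \<Rightarrow> (int ^ 'd \<Rightarrow> int ^ 'd \<Rightarrow> complex) \<Rightarrow> int ^ 'd \<Rightarrow> int ^ 'd \<Rightarrow> int ^ 'd \<Rightarrow> complex"
  where "slant \<alpha> A j = (\<lambda>m n. A m n *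
    (\<Prod>k\<in>UNIV. indicator {real_of_int (j $ k)..<real_of_int (j $ k) + 1}
       (\<alpha> * real_of_int (m $ k) - real_of_int (n $ k))))"

definition slant_norm ::
  "real \<Rightarrow> (int ^ 'd \<Rightarrow> real) \<Rightarrow> (int ^ 'd \<Rightarrow> int ^ 'd \<Rightarrow> complex) \<Rightarrow> ennreal"
  where "slant_norm \<alpha> \<omega> A =
    of_nat (nat \<lceil>1 / \<bar>\<alpha>\<bar>\<rceil> ^ CARD('d)) *
      (\<Sum>\<^sub>\<infinity>j. mat_sup_norm (slant \<alpha> A j) * ennreal (\<omega> j))"

definition slanted_matrices ::
  "real \<Rightarrow> (int ^ 'd \<Rightarrow> real) \<Rightarrow> (int ^ 'd \<Rightarrow> int ^ 'd \<Rightarrow> complex) set"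
  where "slanted_matrices \<alpha> \<omega> = {A. slant_norm \<alpha> \<omega> A < \<infinity>}"

subsection \<open>Sampling\<close>

definition sample ::
  "(int ^ 'd \<Rightarrow> (real ^ 'd) set \<Rightarrow> complex) \<Rightarrow> (real ^ 'd \<Rightarrow> complex) \<Rightarrow> int ^ 'd \<Rightarrow> complex"
  where "sample \<mu> f = (\<lambda>j. complex_measure_integral (\<mu> j) f)"

definition sampler ::
  "(int ^ 'd \<Rightarrow> real ^ 'd \<Rightarrow> complex) \<Rightarrow> ennreal \<Rightarrow> (int ^ 'd \<Rightarrow> (real ^ 'd) set \<Rightarrow> complex) \<Rightarrow> bool"
  where "sampler \<Phi> p \<mu> \<longleftrightarrow>
    (\<exists>C. \<forall>f\<in>V_space p \<Phi>. sample \<mu> f \<in> lp_space p \<and> lp_norm p (sample \<mu> f) \<le> C * Lp_norm p f)"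

definition sampling_matrix ::
  "(int ^ 'd \<Rightarrow> real ^ 'd \<Rightarrow> complex) \<Rightarrow> (int ^ 'd \<Rightarrow> (real ^ 'd) set \<Rightarrow> complex)
     \<Rightarrow> int ^ 'd \<Rightarrow> int ^ 'd \<Rightarrow> complex"
  where "sampling_matrix \<Phi> \<mu> j k = complex_measure_integral (\<mu> j) (\<Phi> k)"

definition stable_sampler ::
  "(int ^ 'd \<Rightarrow> real ^ 'd \<Rightarrow> complex) \<Rightarrow> ennreal \<Rightarrow> (int ^ 'd \<Rightarrow> (real ^ 'd) set \<Rightarrow> complex) \<Rightarrow> bool"
  where "stable_sampler \<Phi> p \<mu> \<longleftrightarrow>
    sampler \<Phi> p \<mu> \<and> lp_bounded p (sampling_matrix \<Phi> \<mu>) \<and>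
    lp_bounded_below p (sampling_matrix \<Phi> \<mu>)"

end

theory Submission
  imports Defs
begin

text \<open>
  The heart of the matter is that a lower bound of a matrix \<open>A\<close> with sufficient off-diagonal decay
  implies a pointwise domination that mentions no exponent. Write
  \<open>G(y) = \<Prod>\<^sub>i (1 + |y\<^sub>i|)\<^sup>-\<^sup>2\<close> (\<open>decay\<close> below). If \<open>\<kappa> \<parallel>x\<parallel>\<^sub>p \<le> \<parallel>A x\<parallel>\<^sub>p\<close> holds for all \<open>x\<close> in \<open>\<ell>\<^sup>1\<close>, for a
  single \<open>p\<close>, then there is \<open>K\<close> with
  \<open>|c\<^sub>n| \<le> K \<Sum>\<^sub>m G(\<alpha>m - n) |(A c)\<^sub>m|\<close> for all bounded \<open>c\<close> and all \<open>n\<close>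
  (lemma \<open>pointwise_domination\<close>). The kernel \<open>G(\<alpha>m - n)\<close> has uniformly bounded row and column sums,
  hence acts boundedly on every \<open>\<ell>\<^sup>q\<close> by the Schur test, and the domination turns into
  \<open>\<parallel>c\<parallel>\<^sub>q \<le> K' \<parallel>A c\<parallel>\<^sub>q\<close> for every \<open>q\<close> at once.

  The domination is obtained by localizing with a weight instead of a cut-off. Fix \<open>n\<close> and put
  \<open>w(x) = G(\<delta>(x - n))\<close> with a small \<open>\<delta> > 0\<close>. For bounded \<open>c\<close> the sequence \<open>w c\<close> lies in \<open>\<ell>\<^sup>1\<close>, takes
  the value \<open>c\<^sub>n\<close> at \<open>n\<close>, and
  \<open>A (w c) = w(\<alpha> \<cdot>) A c + (commutator)\<close>. The weight is submultiplicative, so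
  \<open>|w(k) - w(\<alpha>m)| \<le> \<delta> G(\<alpha>m - k)\<^sup>-\<^sup>1 w(k)\<close> (lemma \<open>decay_scaled_diff_le\<close>); the commutator applied to \<open>c\<close>
  is therefore at most \<open>\<delta> C G(\<alpha>m - k)\<close> applied to \<open>|w c|\<close> as soon as \<open>|a\<^sub>m\<^sub>k| \<le> C G(\<alpha>m - k)\<^sup>2\<close>. By the
  Schur test it has \<open>p\<close>-norm at most \<open>\<delta> C R \<parallel>w c\<parallel>\<^sub>p\<close> and is absorbed by the lower bound, which leaves
  \<open>|c\<^sub>n| \<le> \<parallel>w c\<parallel>\<^sub>p \<lesssim> \<parallel>w(\<alpha> \<cdot>) A c\<parallel>\<^sub>p \<le> \<parallel>w(\<alpha> \<cdot>) A c\<parallel>\<^sub>1\<close>. As \<open>\<delta>\<close> does not depend on \<open>n\<close>, the weight \<open>w\<close> is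
  bounded by a fixed multiple of \<open>G(x - n)\<close>. The condition on the entries of \<open>A\<close> holds because a finite
  slant norm bounds them by the inverse weight, and \<open>s > (d + 1)\<^sup>2 \<ge> 4 d\<close> makes the polynomial weight
  dominate the product \<open>\<Prod>\<^sub>i (1 + |\<alpha>m\<^sub>i - k\<^sub>i|)\<^sup>4\<close> (lemma \<open>slanted_entry_decay\<close>).

  What remains is the sampler inequality for the exponent \<open>0\<close>. The estimate is the one for \<open>\<infinity>\<close>; the
  point is that samples of elements of \<open>V\<^sup>0\<close> are null sequences. A null sequence of coefficients is the
  sum of a finitely supported one, whose samples are even summable, and of one with small supremum, whose
  samples are uniformly small (lemma \<open>sampler_zero\<close>). Splitting the samples requires the integral against
  a complex measure to be additive on bounded Borel functions, which rests on the finiteness of the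
  variations (lemma \<open>finite_measure_pos_variation\<close>), and the synthesized functions are bounded at every
  point by continuity of the generators (lemma \<open>generator_sum_bound\<close>).
\<close>

section \<open>Product kernels with quadratic decay\<close>

definition decay :: "('i::finite \<Rightarrow> real) \<Rightarrow> real"
  where "decay y = (\<Prod>i\<in>UNIV. 1 / (1 + \<bar>y i\<bar>)\<^sup>2)"

lemma decay_pos: "0 < decay y"
  unfolding decay_def by (intro prod_pos) (auto simp: add_pos_nonneg)

lemma decay_nonneg: "0 \<le> decay y"
  using decay_pos[of y] by simp

lemma decay_zero: "decay (\<lambda>i. 0) = 1"
  unfolding decay_def by simp

lemma decay_minus_commute: "decay (\<lambda>i. x i - y i) = decay (\<lambda>i. y i - x i)"
  unfolding decay_def by (simp add: abs_minus_commute)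

lemma shifted_inverse_square_sums:
  fixes F :: "int set"
  assumes "finite F"
  shows "(\<Sum>i\<in>F. 1 / (1 + \<bar>real_of_int (i - i0)\<bar>)\<^sup>2) \<le> 2 * (\<Sum>n. 1 / (1 + real n)\<^sup>2)"
proof -
  have sm: "summable (\<lambda>n. 1 / (1 + real n)\<^sup>2)"
    using inverse_power_summable[of 2, where 'a=real] summable_Suc_iff[of "\<lambda>n. inverse (real n ^ 2)"]
    by (simp add: field_simps)
  have half: "(\<Sum>i\<in>G. 1 / (1 + \<bar>real_of_int (i - i0)\<bar>)\<^sup>2) \<le> (\<Sum>n. 1 / (1 + real n)\<^sup>2)"
    if "finite G" "inj_on (\<lambda>i. nat \<bar>i - i0\<bar>) G" for G
  proof -
    have "(\<Sum>i\<in>G. 1 / (1 + \<bar>real_of_int (i - i0)\<bar>)\<^sup>2)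
        = (\<Sum>n\<in>(\<lambda>i. nat \<bar>i - i0\<bar>) ` G. 1 / (1 + real n)\<^sup>2)"
      by (subst sum.reindex[OF that(2)]) simp
    also have "\<dots> \<le> (\<Sum>n. 1 / (1 + real n)\<^sup>2)"
      by (rule sum_le_suminf[OF sm]) (use that in auto)
    finally show ?thesis .
  qed
  have "(\<Sum>i\<in>F. 1 / (1 + \<bar>real_of_int (i - i0)\<bar>)\<^sup>2)
      = (\<Sum>i\<in>F \<inter> {i0..}. 1 / (1 + \<bar>real_of_int (i - i0)\<bar>)\<^sup>2)
        + (\<Sum>i\<in>F - {i0..}. 1 / (1 + \<bar>real_of_int (i - i0)\<bar>)\<^sup>2)"
    by (rule sum.Int_Diff[OF assms])
  also have "\<dots> \<le> (\<Sum>n. 1 / (1 + real n)\<^sup>2) + (\<Sum>n. 1 / (1 + real n)\<^sup>2)"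
    by (intro add_mono half) (use assms in \<open>auto simp: inj_on_def\<close>)
  finally show ?thesis by simp
qed

text \<open>
  Up to constants, \<open>1 + |\<beta>i - x|\<close> is at least \<open>1 + |i - i\<^sub>0|\<close>, where \<open>i\<^sub>0\<close> is the integer part of
  \<open>x / \<beta>\<close>; this makes the sums bounded uniformly in \<open>x\<close>.
\<close>

lemma line_decay_sums:
  fixes \<beta> :: real
  assumes "\<beta> \<noteq> 0"
  obtains R where
    "\<And>x F. finite F \<Longrightarrow> (\<Sum>i\<in>F. 1 / (1 + \<bar>\<beta> * real_of_int i - x\<bar>)\<^sup>2) \<le> R"
proof -
  define a where "a = min 1 \<bar>\<beta>\<bar>"
  have a: "0 < a" "a \<le> 1" "a \<le> \<bar>\<beta>\<bar>" using assms by (auto simp: a_def)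
  define Z where "Z = 4 / a\<^sup>2 * (2 * (\<Sum>n. 1 / (1 + real n)\<^sup>2))"
  have "(\<Sum>i\<in>F. 1 / (1 + \<bar>\<beta> * real_of_int i - x\<bar>)\<^sup>2) \<le> Z" if "finite F" for x F
  proof -
    define i0 where "i0 = \<lfloor>x / \<beta>\<rfloor>"
    have "1 / (1 + \<bar>\<beta> * real_of_int i - x\<bar>)\<^sup>2 \<le> 4 / a\<^sup>2 * (1 / (1 + \<bar>real_of_int (i - i0)\<bar>)\<^sup>2)" for i
    proof -
      have "1 + \<bar>real_of_int (i - i0)\<bar> \<le> 2 * (1 + \<bar>real_of_int i - x / \<beta>\<bar>)"
      proof -
        define z where "z = x / \<beta>"
        have "real_of_int i0 \<le> z" "z < real_of_int i0 + 1"
          unfolding i0_def z_def by (simp_all add: floor_correct)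
        then show ?thesis unfolding z_def[symmetric] of_int_diff by (simp add: abs_if)
      qed
      then have "a * (1 + \<bar>real_of_int (i - i0)\<bar>) \<le> a * (2 * (1 + \<bar>real_of_int i - x / \<beta>\<bar>))"
        using a by (intro mult_left_mono) auto
      also have "\<dots> = 2 * (a + a * \<bar>real_of_int i - x / \<beta>\<bar>)" by (simp add: algebra_simps)
      also have "\<dots> \<le> 2 * (1 + \<bar>\<beta>\<bar> * \<bar>real_of_int i - x / \<beta>\<bar>)"
        using a by (intro mult_left_mono add_mono mult_right_mono) auto
      also have "\<bar>\<beta>\<bar> * \<bar>real_of_int i - x / \<beta>\<bar> = \<bar>\<beta> * real_of_int i - x\<bar>"
        using assms by (simp add: abs_mult[symmetric] algebra_simps)
      finally have sq: "(a * (1 + \<bar>real_of_int (i - i0)\<bar>))\<^sup>2 \<le> (2 * (1 + \<bar>\<beta> * real_of_int i - x\<bar>))\<^sup>2"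
        using a by (intro power_mono) auto
      have gen: "1 / B\<^sup>2 \<le> 4 / a\<^sup>2 * (1 / A\<^sup>2)" if "(a * A)\<^sup>2 \<le> (2 * B)\<^sup>2" "0 < A" "0 < B" for A B
      proof -
        have "4 / (2 * B)\<^sup>2 \<le> 4 / (a * A)\<^sup>2"
          using that a by (intro divide_left_mono) auto
        then show ?thesis by (simp add: power_mult_distrib)
      qed
      from sq show ?thesis by (rule gen; intro add_pos_nonneg) auto
    qed
    then have "(\<Sum>i\<in>F. 1 / (1 + \<bar>\<beta> * real_of_int i - x\<bar>)\<^sup>2)
        \<le> 4 / a\<^sup>2 * (\<Sum>i\<in>F. 1 / (1 + \<bar>real_of_int (i - i0)\<bar>)\<^sup>2)"
      by (subst sum_distrib_left) (intro sum_mono)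
    also have "\<dots> \<le> Z" unfolding Z_def
      by (intro mult_left_mono shifted_inverse_square_sums that) auto
    finally show ?thesis .
  qed
  then show ?thesis by (rule that)
qed

text \<open>
  A finite subset of the lattice lies in a box, and over a box the sum of the product kernel factors
  into one-dimensional sums.
\<close>

lemma decay_sums:
  fixes \<beta> :: real
  assumes "\<beta> \<noteq> 0"
  shows "\<exists>R. \<forall>x F. finite F \<longrightarrow> (\<Sum>k\<in>F. decay (\<lambda>i. \<beta> * real_of_int ((k :: int ^ 'd) $ i) - x i)) \<le> R"
proof -
  obtain R where R:
    "\<And>x F. finite F \<Longrightarrow> (\<Sum>i\<in>F. 1 / (1 + \<bar>\<beta> * real_of_int i - x\<bar>)\<^sup>2) \<le> R"
    using line_decay_sums[OF assms] by metis
  have "(\<Sum>k\<in>F. decay (\<lambda>i. \<beta> * real_of_int ((k :: int ^ 'd) $ i) - x i)) \<le> R ^ CARD('d)"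
    if "finite F" for x and F :: "(int ^ 'd) set"
  proof -
    define B where "B = (\<lambda>i. (\<lambda>k :: int ^ 'd. k $ i) ` F)"
    have fB: "finite (B i)" for i unfolding B_def using that by simp
    have "(\<Sum>k\<in>F. decay (\<lambda>i. \<beta> * real_of_int (k $ i) - x i))
        = (\<Sum>g\<in>vec_nth ` F. decay (\<lambda>i. \<beta> * real_of_int (g i) - x i))"
      by (subst sum.reindex) (auto simp: inj_on_def vec_nth_inject)
    also have "\<dots> \<le> (\<Sum>g\<in>PiE UNIV B. decay (\<lambda>i. \<beta> * real_of_int (g i) - x i))"
      using fB by (intro sum_mono2 finite_PiE) (auto simp: B_def decay_nonneg)
    also have "\<dots> = (\<Prod>i\<in>UNIV. \<Sum>j\<in>B i. 1 / (1 + \<bar>\<beta> * real_of_int j - x i\<bar>)\<^sup>2)"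
      unfolding decay_def by (rule prod_sum_PiE[symmetric]) (auto simp: fB)
    also have "\<dots> \<le> (\<Prod>i\<in>(UNIV :: 'd set). R)"
      by (intro prod_mono) (auto intro!: R fB sum_nonneg)
    finally show ?thesis by simp
  qed
  then show ?thesis by blast
qed

lemma decay_matrix_sums:
  fixes \<alpha> :: real
  assumes "\<alpha> \<noteq> 0"
  obtains R where "0 < R"
    "\<And>m F. finite F \<Longrightarrow>
       (\<Sum>k\<in>F. decay (\<lambda>i. \<alpha> * real_of_int (m $ i) - real_of_int ((k :: int ^ 'd) $ i))) \<le> R"
    "\<And>k F. finite F \<Longrightarrow>
       (\<Sum>m\<in>F. decay (\<lambda>i. \<alpha> * real_of_int ((m :: int ^ 'd) $ i) - real_of_int (k $ i))) \<le> R"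
proof -
  obtain R1 where R1: "\<And>x F. finite F \<Longrightarrow> (\<Sum>k\<in>F. decay (\<lambda>i. 1 * real_of_int ((k :: int ^ 'd) $ i) - x i)) \<le> R1"
    using decay_sums[of 1] by auto
  obtain R2 where R2: "\<And>x F. finite F \<Longrightarrow> (\<Sum>k\<in>F. decay (\<lambda>i. \<alpha> * real_of_int ((k :: int ^ 'd) $ i) - x i)) \<le> R2"
    using decay_sums[OF assms] by auto
  show ?thesis
  proof (rule that[of "max (max R1 R2) 1"])
    fix F :: "(int ^ 'd) set" assume F: "finite F"
    show "(\<Sum>k\<in>F. decay (\<lambda>i. \<alpha> * real_of_int (m $ i) - real_of_int (k $ i))) \<le> max (max R1 R2) 1" for m :: "int ^ 'd"
      using R1[OF F, of "\<lambda>i. \<alpha> * real_of_int (m $ i)"]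
      by (simp add: decay_minus_commute[of "\<lambda>i. \<alpha> * real_of_int (m $ i)"])
    show "(\<Sum>m\<in>F. decay (\<lambda>i. \<alpha> * real_of_int (m $ i) - real_of_int (k $ i))) \<le> max (max R1 R2) 1" for k :: "int ^ 'd"
      using R2[OF F, of "\<lambda>i. real_of_int (k $ i)"] by simp
  qed simp
qed

text \<open>
  Along the segment from \<open>1\<close> to \<open>g\<close> the product lies below its chord, because its expansion in powers
  of \<open>\<delta>\<close> has nonnegative coefficients. This is the source of the small factor \<open>\<delta>\<close> in the commutator
  estimate.
\<close>

lemma prod_minus_one_le_scaled:
  fixes f g :: "'a \<Rightarrow> real"
  assumes "0 \<le> \<delta>" "\<delta> \<le> 1" "\<And>i. 0 \<le> f i" "\<And>i. 1 \<le> g i" "\<And>i. f i - 1 \<le> \<delta> * (g i - 1)"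
  shows "(\<Prod>i\<in>F. f i) - 1 \<le> \<delta> * ((\<Prod>i\<in>F. g i) - 1)"
proof (induction F rule: infinite_finite_induct)
  case (insert j F)
  let ?X = "\<Prod>i\<in>F. g i" let ?Y = "\<Prod>i\<in>F. f i"
  have X: "1 \<le> ?X" using assms by (intro prod_ge_1) auto
  then have "0 \<le> (g j - 1) * (?X - 1)" using assms by simp
  then have *: "\<delta> * (\<delta> * ((g j - 1) * (?X - 1))) \<le> 1 * (\<delta> * ((g j - 1) * (?X - 1)))"
    using assms X by (intro mult_right_mono mult_nonneg_nonneg) auto
  have "f j * ?Y \<le> (1 + \<delta> * (g j - 1)) * (1 + \<delta> * (?X - 1))"
  proof (rule mult_mono)
    show "f j \<le> 1 + \<delta> * (g j - 1)" using assms(5)[of j] by simp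
    show "?Y \<le> 1 + \<delta> * (?X - 1)" using insert.IH by simp
    show "0 \<le> 1 + \<delta> * (g j - 1)" using assms by simp
    show "0 \<le> ?Y" using assms by (intro prod_nonneg) simp
  qed
  then show ?case using insert.hyps * by (simp add: algebra_simps)
qed auto

text \<open>
  Since \<open>1 + \<delta>|x| \<le> (1 + \<delta>|y|) (1 + \<delta>|x - y|)\<close>, the values of the kernel at \<open>\<delta> u\<close> and \<open>\<delta> v\<close> differ by
  a factor at most \<open>P = \<Prod>\<^sub>i (1 + \<delta>|u\<^sub>i - v\<^sub>i|)\<^sup>2\<close>, in both directions, and \<open>P - 1\<close> is of order \<open>\<delta>\<close>.
\<close>

lemma decay_scaled_diff_le:
  fixes u v :: "'i::finite \<Rightarrow> real"
  assumes "0 \<le> \<delta>" "\<delta> \<le> 1"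
  shows "\<bar>decay (\<lambda>i. \<delta> * u i) - decay (\<lambda>i. \<delta> * v i)\<bar>
     \<le> \<delta> * (\<Prod>i\<in>UNIV. (1 + \<bar>u i - v i\<bar>)\<^sup>2) * decay (\<lambda>i. \<delta> * u i)"
proof -
  define P where "P = (\<Prod>i\<in>UNIV. (1 + \<delta> * \<bar>u i - v i\<bar>)\<^sup>2)"
  have P1: "1 \<le> P" unfolding P_def using assms by (intro prod_ge_1) (auto intro!: one_le_power)
  have submult: "decay (\<lambda>i. \<delta> * y i) \<le> P * decay (\<lambda>i. \<delta> * x i)"
    if "\<And>i. \<bar>x i - y i\<bar> = \<bar>u i - v i\<bar>" for x y :: "'i \<Rightarrow> real"
  proof -
    have "1 / (1 + \<bar>\<delta> * y i\<bar>)\<^sup>2 \<le> (1 + \<delta> * \<bar>u i - v i\<bar>)\<^sup>2 * (1 / (1 + \<bar>\<delta> * x i\<bar>)\<^sup>2)" for i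
    proof -
      have pos: "0 < 1 + \<delta> * \<bar>t\<bar>" for t :: real using assms by (simp add: add_pos_nonneg)
      have "\<delta> * \<bar>x i\<bar> \<le> \<delta> * \<bar>y i\<bar> + \<delta> * \<bar>u i - v i\<bar>"
        using assms that[of i] mult_left_mono[of "\<bar>x i\<bar>" "\<bar>y i\<bar> + \<bar>u i - v i\<bar>" \<delta>]
        by (simp add: algebra_simps)
      moreover have "0 \<le> (\<delta> * \<bar>y i\<bar>) * (\<delta> * \<bar>u i - v i\<bar>)" using assms by simp
      ultimately have "1 + \<delta> * \<bar>x i\<bar> \<le> (1 + \<delta> * \<bar>u i - v i\<bar>) * (1 + \<delta> * \<bar>y i\<bar>)"
        by (simp add: algebra_simps)
      then have "(1 + \<delta> * \<bar>x i\<bar>)\<^sup>2 \<le> ((1 + \<delta> * \<bar>u i - v i\<bar>) * (1 + \<delta> * \<bar>y i\<bar>))\<^sup>2"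
        using assms by (intro power_mono) auto
      then show ?thesis using assms
        using pos[of "x i"] pos[of "y i"]
        by (simp add: abs_mult divide_simps power_mult_distrib)
    qed
    then show ?thesis unfolding decay_def P_def prod.distrib[symmetric]
      by (intro prod_mono) auto
  qed
  have vu: "decay (\<lambda>i. \<delta> * v i) \<le> P * decay (\<lambda>i. \<delta> * u i)"
    and uv: "decay (\<lambda>i. \<delta> * u i) \<le> P * decay (\<lambda>i. \<delta> * v i)"
    by (rule submult; simp add: abs_minus_commute)+
  \<comment> \<open>\<open>P * (2 - P) \<le> 1\<close> turns the comparison \<open>uv\<close> into one by the value at \<open>u\<close>.\<close>
  have "P * ((2 - P) * decay (\<lambda>i. \<delta> * u i)) \<le> 1 * decay (\<lambda>i. \<delta> * u i)"
    unfolding mult.assoc[symmetric] using decay_pos[of "\<lambda>i. \<delta> * u i"] zero_le_power2[of "P - 1"]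
    by (intro mult_right_mono) (simp_all add: power2_eq_square algebra_simps)
  also have "\<dots> \<le> P * decay (\<lambda>i. \<delta> * v i)" using uv by simp
  finally have "(2 - P) * decay (\<lambda>i. \<delta> * u i) \<le> decay (\<lambda>i. \<delta> * v i)"
    by (rule mult_left_le_imp_le) (use P1 in linarith)
  then have "\<bar>decay (\<lambda>i. \<delta> * u i) - decay (\<lambda>i. \<delta> * v i)\<bar> \<le> (P - 1) * decay (\<lambda>i. \<delta> * u i)"
    using vu by (simp add: abs_le_iff algebra_simps)
  also have "P - 1 \<le> \<delta> * ((\<Prod>i\<in>UNIV. (1 + \<bar>u i - v i\<bar>)\<^sup>2) - 1)"
    unfolding P_def
  proof (rule prod_minus_one_le_scaled[OF assms])
    fix i
    have "(1 + \<delta> * t)\<^sup>2 - 1 \<le> \<delta> * ((1 + t)\<^sup>2 - 1)" for t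
    proof -
      have "\<delta> * \<delta> * t\<^sup>2 \<le> \<delta> * 1 * t\<^sup>2"
        using assms by (intro mult_right_mono mult_left_mono) auto
      then show ?thesis by (simp add: power2_eq_square algebra_simps)
    qed
    then show "(1 + \<delta> * \<bar>u i - v i\<bar>)\<^sup>2 - 1 \<le> \<delta> * ((1 + \<bar>u i - v i\<bar>)\<^sup>2 - 1)" .
    show "1 \<le> (1 + \<bar>u i - v i\<bar>)\<^sup>2" by (intro one_le_power) simp
  qed simp
  also have "\<dots> \<le> \<delta> * (\<Prod>i\<in>UNIV. (1 + \<bar>u i - v i\<bar>)\<^sup>2)"
    using assms by (intro mult_left_mono) auto
  finally show ?thesis using decay_pos[of "\<lambda>i. \<delta> * u i"] by (simp add: mult_right_mono)
qed

section \<open>The Schur test\<close>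

text \<open>
  Jensen's inequality for weights of total mass at most \<open>R\<close>: sum the tangent inequality of \<open>t \<mapsto> t\<^sup>r\<close> at
  \<open>y = (\<Sum> b\<^sub>k x\<^sub>k) / R\<close>. Missing mass only helps as \<open>r \<ge> 1\<close>.
\<close>

lemma power_mean_finite:
  fixes b x :: "'a \<Rightarrow> real"
  assumes r: "1 \<le> r" and R: "0 < R" and b: "\<And>k. 0 \<le> b k" "sum b K \<le> R" and x: "\<And>k. 0 \<le> x k"
  shows "(\<Sum>k\<in>K. b k * x k) powr r \<le> R powr (r - 1) * (\<Sum>k\<in>K. b k * x k powr r)"
proof -
  define y where "y = (\<Sum>k\<in>K. b k * x k) / R"
  have sum_eq: "(\<Sum>k\<in>K. b k * x k) = R * y" using R by (simp add: y_def)
  have y0: "0 \<le> y" using R b x by (auto simp: y_def intro!: sum_nonneg divide_nonneg_pos)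
  show ?thesis
  proof (cases "y = 0")
    case True
    then show ?thesis using sum_eq R b by (simp add: sum_nonneg)
  next
    case False
    with y0 have y: "0 < y" by simp
    \<comment> \<open>The tangent inequality from convexity on the positive half-line does not cover \<open>t = 0\<close>.\<close>
    have tangent: "y powr r + r * y powr (r - 1) * (t - y) \<le> t powr r" if "0 \<le> t" for t
    proof (cases "t = 0")
      case True
      have "y powr (r - 1) * y = y powr r" using y by (simp add: powr_diff)
      then show ?thesis using True r mult_right_mono[OF r, of "y powr r"] by (simp add: algebra_simps)
    next
      case False
      with that have t: "0 < t" by simp
      have "r * y powr (r - 1) * (t - y) \<le> t powr r - y powr r"
        by (rule convex_on_imp_above_tangent[of "{0<..}"])
           (use t y r in \<open>auto intro!: powr_convex derivative_eq_intros simp: interior_open\<close>)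
      then show ?thesis by simp
    qed
    define S where "S = sum b K"
    have "S * y powr r + r * y powr (r - 1) * (R * y - S * y)
        = (\<Sum>k\<in>K. b k * (y powr r + r * y powr (r - 1) * (x k - y)))"
      by (simp add: sum_eq[symmetric] S_def algebra_simps sum.distrib sum_subtractf sum_distrib_left sum_distrib_right)
    also have "\<dots> \<le> (\<Sum>k\<in>K. b k * x k powr r)"
      by (intro sum_mono mult_left_mono tangent b x)
    finally have "S * y powr r + r * y powr (r - 1) * (R * y - S * y) \<le> (\<Sum>k\<in>K. b k * x k powr r)" .
    moreover have "r * y powr (r - 1) * (R * y - S * y) = r * ((R - S) * y powr r)"
      using y by (simp add: powr_diff field_simps)
    moreover have "1 * ((R - S) * y powr r) \<le> r * ((R - S) * y powr r)"
      using r b(2) by (intro mult_right_mono) (auto simp: S_def)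
    ultimately have "R * y powr r \<le> (\<Sum>k\<in>K. b k * x k powr r)"
      by (simp add: algebra_simps)
    then have "R powr (r - 1) * (R * y powr r) \<le> R powr (r - 1) * (\<Sum>k\<in>K. b k * x k powr r)"
      by (intro mult_left_mono) auto
    moreover have "R powr (r - 1) * (R * y powr r) = (R * y) powr r"
      using R y by (simp add: powr_mult powr_diff)
    ultimately show ?thesis by (simp add: sum_eq)
  qed
qed

lemma summable_on_of_bounded_sums:
  fixes f :: "'a \<Rightarrow> real"
  assumes "\<And>k. 0 \<le> f k" "\<And>F. finite F \<Longrightarrow> sum f F \<le> R"
  shows "f summable_on UNIV" "infsum f UNIV \<le> R"
proof -
  show "f summable_on UNIV"
    by (rule nonneg_bdd_above_summable_on) (use assms in \<open>auto intro!: bdd_aboveI[of _ R]\<close>)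
  then show "infsum f UNIV \<le> R" by (rule infsum_le_finite_sums) (use assms in auto)
qed

lemma summable_on_mult_bounded:
  fixes f x :: "'a \<Rightarrow> real"
  assumes "f summable_on UNIV" "\<And>k. 0 \<le> f k" "\<And>k. 0 \<le> x k" "\<And>k. x k \<le> M"
  shows "(\<lambda>k. f k * x k) summable_on UNIV"
  by (rule summable_on_comparison_test[OF summable_on_cmult_left[OF assms(1), of M]])
     (use assms in \<open>auto intro: mult_left_mono\<close>)

lemma has_sum_finite_sum:
  fixes f :: "'a \<Rightarrow> 'b \<Rightarrow> 'c::{topological_comm_monoid_add, t2_space}"
  assumes "finite F" "\<And>m. f m summable_on A"
  shows "((\<lambda>k. \<Sum>m\<in>F. f m k) has_sum (\<Sum>m\<in>F. \<Sum>\<^sub>\<infinity>k\<in>A. f m k)) A"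
  using assms by (induction F rule: finite_induct) (auto intro!: has_sum_add has_sum_infsum has_sum_0)

text \<open>
  The row sums enter through Jensen's inequality in each row, the column sums after summing over the
  rows. All bounds are derived for finite sets of rows, so that no interchange of two infinite sums
  occurs.
\<close>

lemma Schur_test_powr:
  fixes B :: "'a \<Rightarrow> 'b \<Rightarrow> real"
  assumes r: "1 \<le> r" and R: "0 < R"
    and B0: "\<And>m k. 0 \<le> B m k"
    and row: "\<And>m F. finite F \<Longrightarrow> (\<Sum>k\<in>F. B m k) \<le> R"
    and col: "\<And>k F. finite F \<Longrightarrow> (\<Sum>m\<in>F. B m k) \<le> R"
    and x: "\<And>k. 0 \<le> x k" "(\<lambda>k. x k powr r) summable_on UNIV"
    and y: "\<And>m. 0 \<le> y m" "\<And>m. y m \<le> (\<Sum>\<^sub>\<infinity>k. B m k * x k)"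
  shows "(\<lambda>m. y m powr r) summable_on UNIV"
    "(\<Sum>\<^sub>\<infinity>m. y m powr r) \<le> R powr r * (\<Sum>\<^sub>\<infinity>k. x k powr r)"
proof -
  let ?X = "\<Sum>\<^sub>\<infinity>k. x k powr r"
  have X0: "0 \<le> ?X" by (intro infsum_nonneg) simp
  have xr_le: "x k powr r \<le> ?X" for k
    using finite_sum_le_infsum[OF x(2), of "{k}"] by simp
  have x_le: "x k \<le> ?X powr (1 / r)" for k
    using powr_mono2[OF _ _ xr_le, of "1 / r" k] r x(1)[of k] by (simp add: powr_powr)
  have sB: "(\<lambda>k. B m k) summable_on UNIV" for m
    by (rule summable_on_of_bounded_sums) (use B0 row in auto)
  have sBx: "(\<lambda>k. B m k * x k) summable_on UNIV" for m
    by (rule summable_on_mult_bounded[OF sB B0 x(1) x_le])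
  have sBxr: "(\<lambda>k. B m k * x k powr r) summable_on UNIV" for m
    by (rule summable_on_mult_bounded[OF sB B0 _ xr_le]) simp
  define T where "T = (\<lambda>m. R powr (r - 1) * (\<Sum>\<^sub>\<infinity>k. B m k * x k powr r))"
  have T0: "0 \<le> T m" for m unfolding T_def by (intro mult_nonneg_nonneg infsum_nonneg) (auto simp: B0)
  have y_T: "y m powr r \<le> T m" for m
  proof -
    have "(\<Sum>\<^sub>\<infinity>k. B m k * x k) \<le> T m powr (1 / r)"
    proof (rule infsum_le_finite_sums[OF sBx])
      fix F :: "'b set" assume F: "finite F"
      have "(\<Sum>k\<in>F. B m k * x k) powr r \<le> R powr (r - 1) * (\<Sum>k\<in>F. B m k * x k powr r)"
        by (rule power_mean_finite[OF r R B0 row[OF F] x(1)])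
      also have "\<dots> \<le> T m" unfolding T_def
        by (intro mult_left_mono finite_sum_le_infsum[OF sBxr F]) (auto simp: B0)
      finally have "((\<Sum>k\<in>F. B m k * x k) powr r) powr (1 / r) \<le> T m powr (1 / r)"
        using r by (intro powr_mono2) auto
      moreover have "0 \<le> (\<Sum>k\<in>F. B m k * x k)" by (intro sum_nonneg) (simp add: B0 x)
      ultimately show "(\<Sum>k\<in>F. B m k * x k) \<le> T m powr (1 / r)"
        using r by (simp add: powr_powr)
    qed
    with y(2)[of m] have "y m \<le> T m powr (1 / r)" by linarith
    then have "y m powr r \<le> (T m powr (1 / r)) powr r"
      using r y(1) by (intro powr_mono2) auto
    then show ?thesis using r T0[of m] by (simp add: powr_powr)
  qed
  have sums: "(\<Sum>m\<in>F. y m powr r) \<le> R powr r * ?X" if F: "finite F" for F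
  proof -
    have "(\<Sum>m\<in>F. y m powr r) \<le> (\<Sum>m\<in>F. T m)" by (intro sum_mono y_T)
    then have y_le: "(\<Sum>m\<in>F. y m powr r) \<le> R powr (r - 1) * (\<Sum>m\<in>F. \<Sum>\<^sub>\<infinity>k. B m k * x k powr r)"
      unfolding T_def by (simp add: sum_distrib_left)
    have "(\<Sum>m\<in>F. \<Sum>\<^sub>\<infinity>k. B m k * x k powr r) = (\<Sum>\<^sub>\<infinity>k. \<Sum>m\<in>F. B m k * x k powr r)"
      using has_sum_finite_sum[OF F, of "\<lambda>m k. B m k * x k powr r" UNIV] sBxr
      by (simp add: has_sum_iff)
    also have "\<dots> \<le> (\<Sum>\<^sub>\<infinity>k. R * x k powr r)"
    proof (rule infsum_mono)
      show "(\<lambda>k. \<Sum>m\<in>F. B m k * x k powr r) summable_on UNIV"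
        using has_sum_finite_sum[OF F, of "\<lambda>m k. B m k * x k powr r" UNIV] sBxr by (auto simp: has_sum_iff)
      show "(\<lambda>k. R * x k powr r) summable_on UNIV" by (intro summable_on_cmult_right x)
      show "(\<Sum>m\<in>F. B m k * x k powr r) \<le> R * x k powr r" for k
        unfolding sum_distrib_right[symmetric] by (intro mult_right_mono col F) simp
    qed
    also have "\<dots> = R * ?X" by (intro infsum_cmult_right x)
    finally have "(\<Sum>m\<in>F. y m powr r) \<le> R powr (r - 1) * (R * ?X)"
      by (intro order.trans[OF y_le] mult_left_mono) auto
    also have "\<dots> = R powr r * ?X" using R by (simp add: powr_diff)
    finally show ?thesis .
  qed
  show "(\<lambda>m. y m powr r) summable_on UNIV" "(\<Sum>\<^sub>\<infinity>m. y m powr r) \<le> R powr r * ?X"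
    using summable_on_of_bounded_sums[OF _ sums] by auto
qed

section \<open>Norm estimates in the sequence spaces\<close>

lemma norm_le_sup_norm:
  assumes "c \<in> lp_space \<infinity>"
  shows "norm (c n) \<le> lp_norm \<infinity> c"
  using assms unfolding lp_space_def lp_norm_def
  by (auto intro!: cSUP_upper simp: bounded_iff bdd_above_def)

lemma sup_norm_le:
  assumes "\<And>n. norm (c n) \<le> M"
  shows "c \<in> lp_space \<infinity>" "lp_norm \<infinity> c \<le> M"
  using assms unfolding lp_space_def lp_norm_def
  by (auto simp: bounded_iff intro!: cSUP_least)

lemma lp_norm_0: "lp_norm 0 = lp_norm \<infinity>"
  by (rule ext) (simp add: lp_norm_def)

lemma Lp_norm_0: "Lp_norm 0 = Lp_norm \<infinity>"
  by (rule ext) (simp add: Lp_norm_def)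

text \<open>
  Norm estimates for the exponent \<open>0\<close> are reduced to \<open>\<infinity>\<close>, which has the same norm; the remaining
  exponents are either \<open>\<infinity>\<close> or a real number \<open>r \<ge> 1\<close>.
\<close>

lemma exponent_cases:
  assumes "1 \<le> p"
  obtains "p = \<infinity>" | r where "1 \<le> r" "p \<noteq> 0" "p \<noteq> \<infinity>" "enn2real p = r"
proof (cases p)
  case (real r)
  then show ?thesis using that(2)[of r] assms by (cases "p = 0") (auto simp: ennreal_le_1 ennreal_1[symmetric] simp del: ennreal_1)
qed (use that in auto)

lemma norm_le_lp_norm:
  assumes p: "1 \<le> p" and c: "c \<in> lp_space p"
  shows "norm (c n) \<le> lp_norm p c"
  using p
proof (cases rule: exponent_cases)
  case 1
  then show ?thesis using c norm_le_sup_norm by metis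
next
  case (2 r)
  then have s: "(\<lambda>n. norm (c n) powr r) summable_on UNIV" using c by (simp add: lp_space_def)
  have "norm (c n) powr r \<le> (\<Sum>\<^sub>\<infinity>n. norm (c n) powr r)"
    using finite_sum_le_infsum[OF s, of "{n}"] by simp
  then have "(norm (c n) powr r) powr (1 / r) \<le> (\<Sum>\<^sub>\<infinity>n. norm (c n) powr r) powr (1 / r)"
    using 2 by (intro powr_mono2) auto
  then show ?thesis using 2 by (simp add: lp_norm_def powr_powr)
qed

lemma lp_space_subset_bounded:
  assumes "p \<in> exponents"
  shows "lp_space p \<subseteq> lp_space \<infinity>"
proof (cases "p = 0")
  case True
  show ?thesis
  proof
    fix c :: "int ^ 'd \<Rightarrow> complex" assume "c \<in> lp_space p"
    then have "(c \<longlongrightarrow> 0) cofinite" using True by (simp add: lp_space_def)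
    then have "eventually (\<lambda>n. dist (c n) 0 < 1) cofinite" by (rule tendstoD) simp
    then have fin: "finite {n. \<not> norm (c n) < 1}" by (simp add: eventually_cofinite)
    have "range c \<subseteq> c ` {n. \<not> norm (c n) < 1} \<union> ball 0 1" by auto
    then have "bounded (range c)"
      by (rule bounded_subset[rotated]) (use fin in \<open>simp add: finite_imp_bounded\<close>)
    then show "c \<in> lp_space \<infinity>" by (simp add: lp_space_def)
  qed
next
  case False
  then have "1 \<le> p" using assms by (auto simp: exponents_def)
  then show ?thesis using norm_le_lp_norm sup_norm_le(1) by blast
qed

lemma summable_imp_lp_space:
  assumes p: "1 \<le> p" and s: "(\<lambda>n. norm (c n)) summable_on UNIV"
  shows "c \<in> lp_space p" "lp_norm p c \<le> (\<Sum>\<^sub>\<infinity>n. norm (c n))"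
proof -
  define S where "S = (\<Sum>\<^sub>\<infinity>n. norm (c n))"
  have le_S: "norm (c n) \<le> S" for n
    using finite_sum_le_infsum[OF s, of "{n}"] by (simp add: S_def)
  have S0: "0 \<le> S" using le_S[of undefined] norm_ge_zero order_trans by blast
  from p have "c \<in> lp_space p \<and> lp_norm p c \<le> S"
  proof (cases rule: exponent_cases)
    case 1
    then show ?thesis using sup_norm_le[of c S] le_S by auto
  next
    case (2 r)
    have le: "norm (c n) powr r \<le> norm (c n) * S powr (r - 1)" for n
    proof (cases "c n = 0")
      case False
      then have "norm (c n) powr r = norm (c n) * norm (c n) powr (r - 1)" by (simp add: powr_diff)
      also have "\<dots> \<le> norm (c n) * S powr (r - 1)"
        using 2 le_S by (intro mult_left_mono powr_mono2) auto
      finally show ?thesis .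
    qed simp
    have s': "(\<lambda>n. norm (c n) * S powr (r - 1)) summable_on UNIV" by (intro summable_on_cmult_left s)
    have sr: "(\<lambda>n. norm (c n) powr r) summable_on UNIV"
      by (rule summable_on_comparison_test[OF s']) (use le in auto)
    have "(\<Sum>\<^sub>\<infinity>n. norm (c n) powr r) \<le> (\<Sum>\<^sub>\<infinity>n. norm (c n) * S powr (r - 1))"
      by (intro infsum_mono sr s' le)
    also have "\<dots> = S * S powr (r - 1)" unfolding S_def by (intro infsum_cmult_left s)
    also have "\<dots> = S powr r" using S0 2 by (cases "S = 0") (auto simp: powr_diff)
    finally have "(\<Sum>\<^sub>\<infinity>n. norm (c n) powr r) powr (1 / r) \<le> (S powr r) powr (1 / r)"
      using 2 by (intro powr_mono2 infsum_nonneg) auto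
    then show ?thesis using 2 sr S0 by (simp add: lp_space_def lp_norm_def powr_powr)
  qed
  then show "c \<in> lp_space p" "lp_norm p c \<le> (\<Sum>\<^sub>\<infinity>n. norm (c n))" by (auto simp: S_def)
qed

text \<open>
  A substitute for Minkowski's inequality, sufficient for absorbing a small error term. The factor
  \<open>2\<close> comes from \<open>(a + b)\<^sup>r \<le> (2 max(a, b))\<^sup>r \<le> 2\<^sup>r (a\<^sup>r + b\<^sup>r)\<close>.
\<close>

lemma lp_norm_quasi_triangle:
  assumes p: "1 \<le> p" and x: "x \<in> lp_space p" and y: "y \<in> lp_space p"
    and z: "\<And>n. norm (z n) \<le> norm (x n) + norm (y n)"
  shows "z \<in> lp_space p" "lp_norm p z \<le> 2 * (lp_norm p x + lp_norm p y)"
proof -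
  from p have "z \<in> lp_space p \<and> lp_norm p z \<le> 2 * (lp_norm p x + lp_norm p y)"
  proof (cases rule: exponent_cases)
    case 1
    have "norm (z n) \<le> 2 * (lp_norm \<infinity> x + lp_norm \<infinity> y)" for n
    proof -
      have "norm (x n) \<le> lp_norm \<infinity> x" "norm (y n) \<le> lp_norm \<infinity> y"
        using norm_le_sup_norm x y unfolding 1 by blast+
      moreover have "t \<le> 2 * (a + b)" if "u \<le> a" "v \<le> b" "t \<le> u + v" "0 \<le> u" "0 \<le> v"
        for a b t u v :: real using that by simp
      ultimately show ?thesis using z[of n] norm_ge_zero by blast
    qed
    then show ?thesis using sup_norm_le[of z] 1 by auto
  next
    case (2 r)
    define X where "X = (\<Sum>\<^sub>\<infinity>n. norm (x n) powr r)"
    define Y where "Y = (\<Sum>\<^sub>\<infinity>n. norm (y n) powr r)"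
    have sx: "(\<lambda>n. norm (x n) powr r) summable_on UNIV" and sy: "(\<lambda>n. norm (y n) powr r) summable_on UNIV"
      using x y 2 by (auto simp: lp_space_def)
    have X0: "0 \<le> X" "0 \<le> Y" unfolding X_def Y_def by (auto intro: infsum_nonneg)
    have le: "norm (z n) powr r \<le> 2 powr r * (norm (x n) powr r + norm (y n) powr r)" for n
    proof -
      have "norm (z n) powr r \<le> (2 * max (norm (x n)) (norm (y n))) powr r"
        using z[of n] 2 by (intro powr_mono2) auto
      also have "\<dots> = 2 powr r * max (norm (x n)) (norm (y n)) powr r" by (simp add: powr_mult)
      also have "\<dots> \<le> 2 powr r * (norm (x n) powr r + norm (y n) powr r)"
        by (intro mult_left_mono) (auto simp: max_def)
      finally show ?thesis .
    qed
    have hs: "((\<lambda>n. 2 powr r * (norm (x n) powr r + norm (y n) powr r)) has_sum 2 powr r * (X + Y)) UNIV"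
      unfolding X_def Y_def by (intro has_sum_cmult_right has_sum_add has_sum_infsum sx sy)
    have sz: "(\<lambda>n. norm (z n) powr r) summable_on UNIV"
      by (rule summable_on_comparison_test[OF has_sum_imp_summable[OF hs]]) (use le in auto)
    have "(\<Sum>\<^sub>\<infinity>n. norm (z n) powr r) \<le> 2 powr r * (X + Y)"
      by (rule has_sum_mono[OF has_sum_infsum[OF sz] hs le])
    also have "X + Y \<le> (X powr (1 / r) + Y powr (1 / r)) powr r"
    proof -
      define a where "a = X powr (1 / r)" define b where "b = Y powr (1 / r)"
      have ab: "0 \<le> a" "0 \<le> b" "X = a powr r" "Y = b powr r"
        using X0 2 by (auto simp: a_def b_def powr_powr)
      have "t powr r \<le> t * (a + b) powr (r - 1)" if "0 \<le> t" "t \<le> a + b" for t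
      proof (cases "t = 0")
        case False
        then have "t powr r = t * t powr (r - 1)" using that by (simp add: powr_diff)
        then show ?thesis using that 2 by (simp add: mult_left_mono powr_mono2)
      qed simp
      from this[of a] this[of b] have "X + Y \<le> (a + b) * (a + b) powr (r - 1)"
        using ab by (simp add: algebra_simps)
      also have "\<dots> = (a + b) powr r" using ab 2 by (cases "a + b = 0") (auto simp: powr_diff)
      finally show ?thesis by (simp add: a_def b_def)
    qed
    finally have "(\<Sum>\<^sub>\<infinity>n. norm (z n) powr r) \<le> (2 * (X powr (1 / r) + Y powr (1 / r))) powr r"
      unfolding powr_mult by simp
    then have "(\<Sum>\<^sub>\<infinity>n. norm (z n) powr r) powr (1 / r) \<le> ((2 * (X powr (1 / r) + Y powr (1 / r))) powr r) powr (1 / r)"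
      using 2 by (intro powr_mono2 infsum_nonneg) auto
    then show ?thesis using 2 sz by (simp add: lp_space_def lp_norm_def powr_powr X_def Y_def)
  qed
  then show "z \<in> lp_space p" "lp_norm p z \<le> 2 * (lp_norm p x + lp_norm p y)" by auto
qed

lemma Schur_test:
  fixes x y :: "int ^ 'd \<Rightarrow> complex"
  assumes p: "1 \<le> p" and R: "0 < R"
    and B0: "\<And>m k. 0 \<le> B m k"
    and row: "\<And>m F. finite F \<Longrightarrow> (\<Sum>k\<in>F. B m k) \<le> R"
    and col: "\<And>k F. finite F \<Longrightarrow> (\<Sum>m\<in>F. B m k) \<le> R"
    and x: "x \<in> lp_space p"
    and y: "\<And>m. norm (y m) \<le> (\<Sum>\<^sub>\<infinity>k. B m k * norm (x k))"
  shows "y \<in> lp_space p" "lp_norm p y \<le> R * lp_norm p x"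
proof -
  from p have "y \<in> lp_space p \<and> lp_norm p y \<le> R * lp_norm p x"
  proof (cases rule: exponent_cases)
    case 1
    have xb: "norm (x k) \<le> lp_norm \<infinity> x" for k using norm_le_sup_norm x 1 by simp
    have "norm (y m) \<le> R * lp_norm \<infinity> x" for m
    proof -
      have sB: "B m summable_on UNIV" "infsum (B m) UNIV \<le> R"
        by (rule summable_on_of_bounded_sums; use B0 row in auto)+
      have "norm (y m) \<le> (\<Sum>\<^sub>\<infinity>k. B m k * norm (x k))" by (rule y)
      also have "\<dots> \<le> (\<Sum>\<^sub>\<infinity>k. B m k * lp_norm \<infinity> x)"
        by (intro infsum_mono summable_on_mult_bounded[OF sB(1) B0 _ xb] summable_on_cmult_left sB
            mult_left_mono xb B0) auto
      also have "\<dots> = infsum (B m) UNIV * lp_norm \<infinity> x" by (intro infsum_cmult_left sB)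
      also have "\<dots> \<le> R * lp_norm \<infinity> x"
        using xb[of undefined] norm_ge_zero[of "x undefined"]
        by (intro mult_right_mono sB) linarith
      finally show ?thesis .
    qed
    then show ?thesis using sup_norm_le[of y] 1 by auto
  next
    case (2 r)
    have "(\<lambda>k. norm (x k) powr r) summable_on UNIV" using x 2 by (simp add: lp_space_def)
    note S = Schur_test_powr[OF 2(1) R B0 row col norm_ge_zero this norm_ge_zero y]
    have "(\<Sum>\<^sub>\<infinity>m. norm (y m) powr r) powr (1 / r) \<le> (R powr r * (\<Sum>\<^sub>\<infinity>k. norm (x k) powr r)) powr (1 / r)"
      using 2 S(2) by (intro powr_mono2 infsum_nonneg) auto
    also have "\<dots> = R * (\<Sum>\<^sub>\<infinity>k. norm (x k) powr r) powr (1 / r)"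
      using R 2 by (simp add: powr_mult powr_powr infsum_nonneg)
    finally show ?thesis using 2 S(1) by (simp add: lp_space_def lp_norm_def)
  qed
  then show "y \<in> lp_space p" "lp_norm p y \<le> R * lp_norm p x" by auto
qed

section \<open>Lower bounds of slanted matrices\<close>

lemma lattice_norm_ge: "\<bar>n $ i\<bar> \<le> lattice_norm n"
  unfolding lattice_norm_def by (rule Max_ge) auto

text \<open>
  This is \<open>4 d \<le> (d + 1)\<^sup>2\<close>. Each coordinate spends two powers on the growth of the localizing weight
  and two on summability.
\<close>

lemma four_mult_dim_le:
  assumes "(real CARD('d::finite) + 1)\<^sup>2 < s"
  shows "real (4 * CARD('d)) \<le> s"
  using assms zero_le_power2[of "real CARD('d) - 1"] by (simp add: power2_eq_square algebra_simps)

text \<open>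
  The entry \<open>a\<^sub>m\<^sub>k\<close> occurs in the slant whose index is the integer part of \<open>\<alpha>m - k\<close>, so the weighted
  sum of the slants bounds it by the inverse weight of that index.
\<close>

lemma slanted_entry_decay:
  fixes A :: "int ^ 'd \<Rightarrow> int ^ 'd \<Rightarrow> complex"
  assumes s: "real (4 * CARD('d)) \<le> s" and \<alpha>: "\<alpha> \<noteq> 0"
    and A: "A \<in> slanted_matrices \<alpha> (poly_weight s)"
  obtains C where
    "\<And>m k. norm (A m k) * (\<Prod>i\<in>UNIV. (1 + \<bar>\<alpha> * real_of_int (m $ i) - real_of_int (k $ i)\<bar>) ^ 4) \<le> C"
proof -
  let ?t = "\<lambda>j. mat_sup_norm (slant \<alpha> A j) * ennreal (poly_weight s j)"
  let ?S = "\<Sum>\<^sub>\<infinity>j. ?t j"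
  \<comment> \<open>The combinatorial factor of the slant norm is at least \<open>1\<close>, so finiteness passes to the sum.\<close>
  have "0 < 1 / \<bar>\<alpha>\<bar>" using \<alpha> by simp
  then have "0 < nat \<lceil>1 / \<bar>\<alpha>\<bar>\<rceil>" by simp
  then have "of_nat (nat \<lceil>1 / \<bar>\<alpha>\<bar>\<rceil> ^ CARD('d)) \<noteq> (0 :: ennreal)" by simp
  then have fin: "?S < \<infinity>"
    using A by (auto simp: slanted_matrices_def slant_norm_def ennreal_mult_less_top)
  define C where "C = 2 ^ (4 * CARD('d)) * enn2real ?S"
  have "norm (A m k) * (\<Prod>i\<in>UNIV. (1 + \<bar>\<alpha> * real_of_int (m $ i) - real_of_int (k $ i)\<bar>) ^ 4) \<le> C" for m k
  proof -
    define y where "y = (\<lambda>i. \<alpha> * real_of_int (m $ i) - real_of_int (k $ i))"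
    define j :: "int ^ 'd" where "j = (\<chi> i. \<lfloor>y i\<rfloor>)"
    define L where "L = 1 + real_of_int (lattice_norm j)"
    have "0 \<le> lattice_norm j" using lattice_norm_ge[of j undefined] by linarith
    then have L1: "1 \<le> L" by (simp add: L_def)
    have "slant \<alpha> A j m k = A m k"
      by (simp add: slant_def j_def y_def floor_correct indicator_def)
    then have "ennreal (norm (A m k)) \<le> mat_sup_norm (slant \<alpha> A j)"
      unfolding mat_sup_norm_def by (intro SUP_upper2[of m] SUP_upper2[of k]) auto
    then have "ennreal (norm (A m k)) * ennreal (poly_weight s j) \<le> ?t j"
      by (rule mult_right_mono) simp
    also have "?t j \<le> ?S"
      using infsum_mono_neutral[of ?t "{j}" ?t UNIV] nonneg_summable_on_complete[of UNIV ?t] by simp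
    finally have "ennreal (norm (A m k) * poly_weight s j) \<le> ennreal (enn2real ?S)"
      using fin by (simp add: ennreal_mult poly_weight_def)
    then have weighted: "norm (A m k) * poly_weight s j \<le> enn2real ?S" by simp
    have "(\<Prod>i\<in>UNIV. (1 + \<bar>y i\<bar>) ^ 4) \<le> (\<Prod>i\<in>(UNIV :: 'd set). (2 * L) ^ 4)"
    proof (intro prod_mono conjI power_mono)
      fix i
      have "real_of_int \<bar>j $ i\<bar> \<le> real_of_int (lattice_norm j)"
        using lattice_norm_ge[of j i] by (simp only: of_int_le_iff)
      then have "\<bar>real_of_int \<lfloor>y i\<rfloor>\<bar> \<le> real_of_int (lattice_norm j)" by (simp add: j_def)
      moreover have "\<bar>y i\<bar> \<le> \<bar>real_of_int \<lfloor>y i\<rfloor>\<bar> + 1" by linarith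
      ultimately show "1 + \<bar>y i\<bar> \<le> 2 * L" using L1 by (simp add: L_def)
    qed auto
    also have "\<dots> = 2 ^ (4 * CARD('d)) * L powr real (4 * CARD('d))"
    proof -
      have "L powr real (4 * CARD('d)) = L ^ (4 * CARD('d))" using L1 by (intro powr_realpow) simp
      moreover have "(\<Prod>i\<in>(UNIV :: 'd set). (2 * L) ^ 4) = (2 * L) ^ (4 * CARD('d))"
        by (simp only: prod_constant power_mult)
      ultimately show ?thesis by (simp only: power_mult_distrib)
    qed
    also have "\<dots> \<le> 2 ^ (4 * CARD('d)) * poly_weight s j"
      unfolding poly_weight_def L_def[symmetric] using s L1 by (intro mult_left_mono powr_mono) auto
    finally have "norm (A m k) * (\<Prod>i\<in>UNIV. (1 + \<bar>y i\<bar>) ^ 4)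
        \<le> norm (A m k) * (2 ^ (4 * CARD('d)) * poly_weight s j)"
      by (intro mult_left_mono) auto
    also have "\<dots> = 2 ^ (4 * CARD('d)) * (norm (A m k) * poly_weight s j)" by simp
    also have "\<dots> \<le> C" unfolding C_def using weighted by (intro mult_left_mono) auto
    finally show ?thesis by (simp add: y_def)
  qed
  then show ?thesis using that by blast
qed

text \<open>
  Localization around \<open>n\<close> by the weight \<open>w\<close>. The parameter \<open>\<delta>\<close> is chosen such that the commutator of
  \<open>A\<close> and \<open>w\<close> costs at most half of the lower bound \<open>\<kappa>\<close>, and it is the same for all \<open>n\<close>. The
  resulting bound of \<open>\<parallel>w c\<parallel>\<^sub>p\<close> by a multiple of \<open>\<parallel>w(\<alpha> \<cdot>) A c\<parallel>\<^sub>p\<close> is weakened on the left to the single term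
  \<open>|c\<^sub>n|\<close> and on the right to the \<open>\<ell>\<^sup>1\<close> norm, so the exponent \<open>p\<close> disappears from the conclusion.
\<close>

lemma pointwise_domination:
  fixes A :: "int ^ 'd \<Rightarrow> int ^ 'd \<Rightarrow> complex"
  assumes \<alpha>: "\<alpha> \<noteq> 0"
    and C: "\<And>m k. norm (A m k) * (\<Prod>i\<in>UNIV. (1 + \<bar>\<alpha> * real_of_int (m $ i) - real_of_int (k $ i)\<bar>) ^ 4) \<le> C"
    and p: "1 \<le> p" and \<kappa>: "0 < \<kappa>"
    and below: "\<And>x. (\<lambda>n. norm (x n)) summable_on UNIV \<Longrightarrow> \<kappa> * lp_norm p x \<le> lp_norm p (mat_app A x)"
  obtains K where "0 < K"
    "\<And>c n. c \<in> lp_space \<infinity> \<Longrightarrow>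
       norm (c n) \<le> (\<Sum>\<^sub>\<infinity>m. K * decay (\<lambda>i. \<alpha> * real_of_int (m $ i) - real_of_int (n $ i)) * norm (mat_app A c m))"
proof -
  define G where "G = (\<lambda>m k :: int ^ 'd. decay (\<lambda>i. \<alpha> * real_of_int (m $ i) - real_of_int (k $ i)))"
  define Q where "Q = (\<lambda>m k :: int ^ 'd. \<Prod>i\<in>UNIV. (1 + \<bar>\<alpha> * real_of_int (m $ i) - real_of_int (k $ i)\<bar>)\<^sup>2)"
  define D where "D = max C 1"
  have G0: "0 \<le> G m k" for m k by (simp add: G_def decay_nonneg)
  have Q1: "1 \<le> Q m k" for m k unfolding Q_def by (intro prod_ge_1) (simp add: one_le_power)
  have GQ: "G m k = 1 / Q m k" for m k by (simp add: G_def Q_def decay_def prod_dividef)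
  have AQ: "norm (A m k) * Q m k \<le> D * G m k" for m k
  proof -
    have "norm (A m k) * (Q m k * Q m k) \<le> D"
      using C[of m k] unfolding Q_def prod.distrib[symmetric] D_def
      by (simp add: power2_eq_square power4_eq_xxxx mult.assoc)
    then show ?thesis using Q1[of m k] by (simp add: GQ field_simps)
  qed
  have A_le: "norm (A m k) \<le> D * G m k" for m k
    using AQ[of m k] mult_left_mono[OF Q1[of m k], of "norm (A m k)"] by simp
  obtain R where R: "0 < R" and row: "\<And>m F. finite F \<Longrightarrow> (\<Sum>k\<in>F. G m k) \<le> R"
    and col: "\<And>k F. finite F \<Longrightarrow> (\<Sum>m\<in>F. G m k) \<le> R"
    using decay_matrix_sums[OF \<alpha>] unfolding G_def by blast
  have DR: "1 \<le> D" "0 < R" using R by (auto simp: D_def)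
  \<comment> \<open>The \<open>4\<close> is the product of the quasi-triangle constant \<open>2\<close> and the \<open>2\<close> that leaves half of \<open>\<kappa>\<close>.\<close>
  define \<delta> where "\<delta> = min 1 (\<kappa> / (4 * D * R))"
  have \<delta>: "0 < \<delta>" "\<delta> \<le> 1" using \<kappa> DR by (auto simp: \<delta>_def)
  have "\<delta> * (4 * D * R) \<le> \<kappa> / (4 * D * R) * (4 * D * R)"
    using DR by (intro mult_right_mono) (auto simp: \<delta>_def)
  then have small: "4 * (\<delta> * D * R) \<le> \<kappa>" using DR by (simp add: mult_ac)
  define K where "K = 4 / \<kappa> * (1 / \<delta>\<^sup>2) ^ CARD('d)"
  have "norm (c n) \<le> (\<Sum>\<^sub>\<infinity>m. K * G m n * norm (mat_app A c m))" if c: "c \<in> lp_space \<infinity>" for c n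
  proof -
    let ?b = "mat_app A c"
    define w where "w = (\<lambda>k :: int ^ 'd. decay (\<lambda>i. \<delta> * (real_of_int (k $ i) - real_of_int (n $ i))))"
    define v where "v = (\<lambda>m :: int ^ 'd. decay (\<lambda>i. \<delta> * (\<alpha> * real_of_int (m $ i) - real_of_int (n $ i))))"
    have w0: "0 \<le> w k" and v0: "0 \<le> v k" for k by (auto simp: w_def v_def decay_nonneg)
    have sw: "w summable_on UNIV" and sv: "v summable_on UNIV"
    proof -
      obtain W where "\<And>x F. finite F \<Longrightarrow> (\<Sum>k\<in>F. decay (\<lambda>i. \<delta> * real_of_int ((k :: int ^ 'd) $ i) - x i)) \<le> W"
        using decay_sums[of \<delta>] \<delta> by auto
      from this[of _ "\<lambda>i. \<delta> * real_of_int (n $ i)"] show "w summable_on UNIV"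
        by (intro summable_on_of_bounded_sums(1)[where R = W, OF w0]) (simp add: w_def algebra_simps)
      obtain W where "\<And>x F. finite F \<Longrightarrow> (\<Sum>k\<in>F. decay (\<lambda>i. (\<delta> * \<alpha>) * real_of_int ((k :: int ^ 'd) $ i) - x i)) \<le> W"
        using decay_sums[of "\<delta> * \<alpha>"] \<delta> \<alpha> by auto
      from this[of _ "\<lambda>i. \<delta> * real_of_int (n $ i)"] show "v summable_on UNIV"
        by (intro summable_on_of_bounded_sums(1)[where R = W, OF v0]) (simp add: v_def algebra_simps)
    qed
    have c_le: "norm (c k) \<le> lp_norm \<infinity> c" for k by (rule norm_le_sup_norm[OF c])
    have sG: "G m summable_on UNIV" for m
      by (rule summable_on_of_bounded_sums(1)[OF G0 row])
    have sA: "(\<lambda>k. A m k * u k) summable_on UNIV"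
      and A_bound: "norm (mat_app A u m) \<le> (\<Sum>\<^sub>\<infinity>k. D * G m k * norm (u k))"
      if u: "\<And>k. norm (u k) \<le> M" for u m M
    proof -
      have s1: "(\<lambda>k. D * G m k * norm (u k)) summable_on UNIV"
        by (rule summable_on_mult_bounded[OF summable_on_cmult_right[OF sG] _ _ u])
           (use DR G0 in auto)
      have le: "norm (A m k * u k) \<le> D * G m k * norm (u k)" for k
        unfolding norm_mult by (intro mult_right_mono A_le) auto
      have s2: "(\<lambda>k. norm (A m k * u k)) summable_on UNIV"
        by (rule summable_on_comparison_test[OF s1]) (use le in auto)
      then show "(\<lambda>k. A m k * u k) summable_on UNIV" by (rule abs_summable_summable)
      have "norm (mat_app A u m) \<le> (\<Sum>\<^sub>\<infinity>k. norm (A m k * u k))"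
        unfolding mat_app_def by (rule norm_infsum_bound[OF s2])
      also have "\<dots> \<le> (\<Sum>\<^sub>\<infinity>k. D * G m k * norm (u k))" by (rule infsum_mono[OF s2 s1 le])
      finally show "norm (mat_app A u m) \<le> (\<Sum>\<^sub>\<infinity>k. D * G m k * norm (u k))" .
    qed
    have scaled_sums: "(\<Sum>k\<in>F. e * G m k) \<le> e * R" "(\<Sum>m\<in>F. e * G m k) \<le> e * R"
      if "finite F" "0 \<le> e" for e F m k
      unfolding sum_distrib_left[symmetric] by (intro mult_left_mono row col that)+
    have b: "?b \<in> lp_space \<infinity>"
      by (rule Schur_test(1)[OF _ _ _ scaled_sums c A_bound[OF c_le]]) (use DR G0 in auto)
    \<comment> \<open>The localized coefficients, the localized image, and the commutator applied to \<open>c\<close>.\<close>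
    define x where "x = (\<lambda>k. of_real (w k) * c k)"
    define y where "y = (\<lambda>m. of_real (v m) * ?b m)"
    define z where "z = (\<lambda>m. mat_app A x m - y m)"
    have nx: "norm (x k) = w k * norm (c k)" for k using w0 by (simp add: x_def norm_mult)
    have ny: "norm (y k) = v k * norm (?b k)" for k using v0 by (simp add: y_def norm_mult)
    have sx: "(\<lambda>k. norm (x k)) summable_on UNIV"
      unfolding nx by (rule summable_on_mult_bounded[OF sw w0 _ c_le]) simp
    have sy: "(\<lambda>k. norm (y k)) summable_on UNIV"
      unfolding ny by (rule summable_on_mult_bounded[OF sv v0 _ norm_le_sup_norm[OF b]]) simp
    have x_le: "norm (x k) \<le> (\<Sum>\<^sub>\<infinity>k. norm (x k))" for k
      using finite_sum_le_infsum[OF sx, of "{k}"] by simp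
    have z_le: "norm (z m) \<le> (\<Sum>\<^sub>\<infinity>k. \<delta> * D * G m k * norm (x k))" for m
    proof -
      let ?e = "\<lambda>k. A m k * (of_real (w k - v m) * c k)"
      have "((\<lambda>k. A m k * x k + - (of_real (v m) * (A m k * c k))) has_sum (mat_app A x m + - (of_real (v m) * ?b m))) UNIV"
        unfolding mat_app_def
        by (intro has_sum_add has_sum_uminusI has_sum_cmult_right has_sum_infsum sA[OF x_le] sA[OF c_le])
      then have hs: "(?e has_sum z m) UNIV" by (simp add: z_def y_def x_def algebra_simps)
      have s1: "(\<lambda>k. \<delta> * D * G m k * norm (x k)) summable_on UNIV"
        by (rule summable_on_mult_bounded[OF summable_on_cmult_right[OF sG] _ _ x_le])
           (use DR G0 \<delta> in auto)
      have le: "norm (?e k) \<le> \<delta> * D * G m k * norm (x k)" for k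
      proof -
        have "\<bar>w k - v m\<bar> \<le> \<delta> * Q m k * w k"
          using decay_scaled_diff_le[of \<delta> "\<lambda>i. real_of_int (k $ i) - real_of_int (n $ i)"
              "\<lambda>i. \<alpha> * real_of_int (m $ i) - real_of_int (n $ i)"] \<delta>
          by (simp add: w_def v_def Q_def abs_minus_commute)
        then have "norm (?e k) \<le> norm (A m k) * (\<delta> * Q m k * w k * norm (c k))"
          unfolding norm_mult norm_of_real by (intro mult_left_mono mult_right_mono) auto
        also have "\<dots> = (norm (A m k) * Q m k) * (\<delta> * norm (x k))" by (simp add: nx)
        also have "\<dots> \<le> (D * G m k) * (\<delta> * norm (x k))"
          using \<delta> by (intro mult_right_mono AQ) auto
        finally show ?thesis by (simp add: mult_ac)
      qed
      have s2: "(\<lambda>k. norm (?e k)) summable_on UNIV"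
        by (rule summable_on_comparison_test[OF s1]) (use le in auto)
      have "norm (z m) \<le> (\<Sum>\<^sub>\<infinity>k. norm (?e k))"
        using norm_infsum_bound[OF s2] hs by (simp add: has_sum_iff)
      also have "\<dots> \<le> (\<Sum>\<^sub>\<infinity>k. \<delta> * D * G m k * norm (x k))" by (rule infsum_mono[OF s2 s1 le])
      finally show ?thesis .
    qed
    note x_lp = summable_imp_lp_space[OF p sx] and y_lp = summable_imp_lp_space[OF p sy]
    have z_lp: "z \<in> lp_space p" "lp_norm p z \<le> \<delta> * D * R * lp_norm p x"
      by (rule Schur_test[OF p _ _ scaled_sums x_lp(1) z_le]; use DR G0 \<delta> in auto)+
    have "\<kappa> * lp_norm p x \<le> lp_norm p (mat_app A x)" by (rule below[OF sx])
    also have "\<dots> \<le> 2 * (lp_norm p y + lp_norm p z)"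
      by (rule lp_norm_quasi_triangle(2)[OF p y_lp(1) z_lp(1)]) (simp add: z_def norm_triangle_sub)
    also have "\<dots> \<le> 2 * lp_norm p y + 2 * (\<delta> * D * R * lp_norm p x)" using z_lp(2) by simp
    also have "\<dots> \<le> 2 * lp_norm p y + \<kappa> / 2 * lp_norm p x"
      using mult_right_mono[OF small, of "lp_norm p x"] norm_le_lp_norm[OF p x_lp(1), of n]
        norm_ge_zero[of "x n"] by (simp add: mult_ac)
    finally have "\<kappa> * lp_norm p x \<le> 4 * lp_norm p y" by simp
    then have "lp_norm p x \<le> 4 / \<kappa> * lp_norm p y" using \<kappa> by (simp add: field_simps)
    moreover have "norm (c n) \<le> lp_norm p x"
      using norm_le_lp_norm[OF p x_lp(1), of n] unfolding nx by (simp add: w_def decay_zero)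
    moreover have "4 / \<kappa> * lp_norm p y \<le> 4 / \<kappa> * (\<Sum>\<^sub>\<infinity>m. v m * norm (?b m))"
      using y_lp(2) \<kappa> unfolding ny by (intro mult_left_mono) auto
    ultimately have "norm (c n) \<le> 4 / \<kappa> * (\<Sum>\<^sub>\<infinity>m. v m * norm (?b m))" by linarith
    also have "\<dots> = (\<Sum>\<^sub>\<infinity>m. 4 / \<kappa> * (v m * norm (?b m)))"
      by (rule infsum_cmult_right[symmetric]) (use sy ny in simp)
    also have "\<dots> \<le> (\<Sum>\<^sub>\<infinity>m. K * G m n * norm (?b m))"
    proof (rule infsum_mono)
      show "(\<lambda>m. 4 / \<kappa> * (v m * norm (?b m))) summable_on UNIV"
        by (intro summable_on_cmult_right) (use sy ny in simp)
      have "(\<lambda>m. G m n) summable_on UNIV" by (rule summable_on_of_bounded_sums(1)[OF G0 col])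
      then show "(\<lambda>m. K * G m n * norm (?b m)) summable_on UNIV"
        by (intro summable_on_mult_bounded[OF summable_on_cmult_right _ _ norm_le_sup_norm[OF b]])
           (use \<kappa> G0 in \<open>auto simp: K_def\<close>)
      fix m
      \<comment> \<open>As \<open>\<delta> \<le> 1\<close>, rescaling the argument of the kernel costs a factor \<open>\<delta>\<^sup>-\<^sup>2\<close> per coordinate.\<close>
      have "v m \<le> (\<Prod>i\<in>UNIV. 1 / \<delta>\<^sup>2 * (1 / (1 + \<bar>\<alpha> * real_of_int (m $ i) - real_of_int (n $ i)\<bar>)\<^sup>2))"
        unfolding v_def decay_def
      proof (intro prod_mono conjI)
        fix i
        let ?t = "\<bar>\<alpha> * real_of_int (m $ i) - real_of_int (n $ i)\<bar>"
        have "(\<delta> * (1 + ?t))\<^sup>2 \<le> (1 + \<delta> * ?t)\<^sup>2"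
          using \<delta> by (intro power_mono) (auto simp: algebra_simps)
        then have "1 / (1 + \<delta> * ?t)\<^sup>2 \<le> 1 / (\<delta> * (1 + ?t))\<^sup>2"
          using \<delta> by (intro frac_le zero_less_power mult_pos_pos add_pos_nonneg) auto
        then show "1 / (1 + \<bar>\<delta> * (\<alpha> * real_of_int (m $ i) - real_of_int (n $ i))\<bar>)\<^sup>2
            \<le> 1 / \<delta>\<^sup>2 * (1 / (1 + ?t)\<^sup>2)"
          using \<delta> by (simp add: abs_mult power_mult_distrib)
      qed auto
      also have "\<dots> = (1 / \<delta>\<^sup>2) ^ CARD('d) * G m n" by (simp only: prod.distrib prod_constant G_def decay_def)
      finally have "4 / \<kappa> * v m \<le> K * G m n"
        using mult_left_mono[of "v m" "(1 / \<delta>\<^sup>2) ^ CARD('d) * G m n" "4 / \<kappa>"] \<kappa>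
        unfolding K_def by (simp only: mult.assoc) simp
      then show "4 / \<kappa> * (v m * norm (?b m)) \<le> K * G m n * norm (?b m)"
        unfolding mult.assoc[of "4 / \<kappa>", symmetric] by (rule mult_right_mono) simp
    qed
    finally show ?thesis .
  qed
  moreover have "0 < K" using \<kappa> \<delta> by (simp add: K_def)
  ultimately show ?thesis using that unfolding G_def by blast
qed

text \<open>
  Beyond a finite set that captures the sum up to \<open>e / 2\<close>, each single term is at most \<open>e / 2\<close>.
\<close>

lemma summable_imp_null_sequence:
  assumes s: "(\<lambda>n. norm (c n)) summable_on UNIV"
  shows "c \<in> lp_space 0"
proof -
  have "eventually (\<lambda>n. dist (c n) 0 < e) cofinite" if "e > 0" for e
  proof -
    obtain F where F: "finite F" and d: "dist (\<Sum>n\<in>F. norm (c n)) (\<Sum>\<^sub>\<infinity>n. norm (c n)) \<le> e / 2"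
      using infsum_finite_approximation[OF s, of "e / 2"] \<open>e > 0\<close> by auto
    have "norm (c n) < e" if "n \<notin> F" for n
    proof -
      have "norm (c n) + (\<Sum>n\<in>F. norm (c n)) \<le> (\<Sum>\<^sub>\<infinity>n. norm (c n))"
        using finite_sum_le_infsum[OF s, of "insert n F"] F that by simp
      then show ?thesis using d \<open>e > 0\<close> unfolding dist_real_def by linarith
    qed
    then have "{n. \<not> dist (c n) 0 < e} \<subseteq> F" by auto
    then show ?thesis using F finite_subset unfolding eventually_cofinite by blast
  qed
  then have "(c \<longlongrightarrow> 0) cofinite" by (rule tendstoI)
  then show ?thesis by (simp add: lp_space_def)
qed

text \<open>
  The pointwise domination of \<open>|c|\<close> by a Schur-bounded kernel applied to \<open>|A c|\<close> does not refer to \<open>p\<close>,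
  so the Schur test yields the lower bound for every exponent.
\<close>

lemma slanted_bounded_below_transfer:
  fixes A :: "int ^ 'd \<Rightarrow> int ^ 'd \<Rightarrow> complex"
  assumes s: "real (4 * CARD('d)) \<le> s" and \<alpha>: "\<alpha> \<noteq> 0"
    and A: "A \<in> slanted_matrices \<alpha> (poly_weight s)"
    and bounded: "lp_bounded q A"
    and p: "p \<in> exponents" "lp_bounded_below p A"
    and q: "q \<in> exponents"
  shows "lp_bounded_below q A"
proof -
  obtain \<kappa> where \<kappa>: "0 < \<kappa>" "\<And>c. c \<in> lp_space p \<Longrightarrow> \<kappa> * lp_norm p c \<le> lp_norm p (mat_app A c)"
    using p(2) unfolding lp_bounded_below_def by auto
  \<comment> \<open>The norms for the exponents \<open>0\<close> and \<open>\<infinity>\<close> coincide.\<close>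
  define p' where "p' = (if p = 0 then \<infinity> else p)"
  have p': "1 \<le> p'" "lp_norm p' = lp_norm p"
    using p(1) by (auto simp: p'_def exponents_def lp_norm_0)
  have below: "\<kappa> * lp_norm p' x \<le> lp_norm p' (mat_app A x)" if x: "(\<lambda>n. norm (x n)) summable_on UNIV" for x
  proof -
    have "x \<in> lp_space p"
      using summable_imp_null_sequence[OF x] summable_imp_lp_space(1)[OF p'(1) x]
      by (cases "p = 0") (auto simp: p'_def)
    then show ?thesis using \<kappa>(2) by (simp add: p'(2))
  qed
  obtain C where C: "\<And>m k. norm (A m k) *
      (\<Prod>i\<in>UNIV. (1 + \<bar>\<alpha> * real_of_int (m $ i) - real_of_int (k $ i)\<bar>) ^ 4) \<le> C"
    using slanted_entry_decay[OF s \<alpha> A] by blast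
  obtain K where K: "0 < K" "\<And>c n. c \<in> lp_space \<infinity> \<Longrightarrow> norm (c n) \<le>
      (\<Sum>\<^sub>\<infinity>m. K * decay (\<lambda>i. \<alpha> * real_of_int (m $ i) - real_of_int (n $ i)) * norm (mat_app A c m))"
    using pointwise_domination[OF \<alpha> C p'(1) \<kappa>(1) below] by blast
  obtain R where R: "0 < R"
    "\<And>m F. finite F \<Longrightarrow>
       (\<Sum>k\<in>F. decay (\<lambda>i. \<alpha> * real_of_int (m $ i) - real_of_int ((k :: int ^ 'd) $ i))) \<le> R"
    "\<And>k F. finite F \<Longrightarrow>
       (\<Sum>m\<in>F. decay (\<lambda>i. \<alpha> * real_of_int ((m :: int ^ 'd) $ i) - real_of_int (k $ i))) \<le> R"
    using decay_matrix_sums[OF \<alpha>, where 'd = 'd] by blast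
  have domination: "lp_norm q' c \<le> K * R * lp_norm q' (mat_app A c)"
    if q': "1 \<le> q'" and c: "c \<in> lp_space \<infinity>" and b: "mat_app A c \<in> lp_space q'" for q' c
  proof (rule Schur_test(2)[OF q' _ _ _ _ b K(2)[OF c]])
    show "0 < K * R" using K R by simp
    show "0 \<le> K * decay (\<lambda>i. \<alpha> * real_of_int (k $ i) - real_of_int (m $ i))" for m k :: "int ^ 'd"
      using K by (simp add: decay_nonneg)
    fix F :: "(int ^ 'd) set" assume F: "finite F"
    show "(\<Sum>k\<in>F. K * decay (\<lambda>i. \<alpha> * real_of_int (k $ i) - real_of_int (m $ i))) \<le> K * R" for m
      unfolding sum_distrib_left[symmetric] using K by (intro mult_left_mono R(3) F) simp
    show "(\<Sum>m\<in>F. K * decay (\<lambda>i. \<alpha> * real_of_int (k $ i) - real_of_int (m $ i))) \<le> K * R" for k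
      unfolding sum_distrib_left[symmetric] using K by (intro mult_left_mono R(2) F) simp
  qed
  have "lp_norm q c \<le> K * R * lp_norm q (mat_app A c)" if c: "c \<in> lp_space q" for c
  proof -
    have b: "mat_app A c \<in> lp_space q" using bounded c unfolding lp_bounded_def by blast
    have inf: "lp_space q \<subseteq> lp_space \<infinity>" by (rule lp_space_subset_bounded[OF q])
    show ?thesis
    proof (cases "q = 0")
      case True
      then show ?thesis using domination[of \<infinity> c] b c inf by (auto simp: lp_norm_0)
    next
      case False
      then have "1 \<le> q" using q by (auto simp: exponents_def)
      then show ?thesis using domination b c inf by blast
    qed
  qed
  then have "1 / (K * R) * lp_norm q c \<le> lp_norm q (mat_app A c)" if "c \<in> lp_space q" for c
    using that K R by (simp add: field_simps)
  moreover have "0 < 1 / (K * R)" using K R by simp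
  ultimately show ?thesis unfolding lp_bounded_below_def by blast
qed

section \<open>Integration against complex measures\<close>

text \<open>
  Any measure built from a generating function is zero if that function is not countably additive, so
  \<open>pos_variation\<close> is a measure on the Borel sets for every set function.
\<close>

lemma sets_pos_variation [simp, measurable_cong]: "sets (pos_variation \<sigma>) = sets borel"
  unfolding pos_variation_def using sets.sigma_sets_eq[of "borel :: (real ^ 'a) measure"]
  by (simp add: sets_measure_of_conv)

text \<open>
  If the variation \<open>P\<close> of a set \<open>E\<close> is infinite, then \<open>E\<close> has a subset \<open>B\<close> with \<open>\<sigma>(B) > 1 + |\<sigma>(E)|\<close>, and
  both \<open>B\<close> and \<open>E - B\<close> have \<open>|\<sigma>| \<ge> 1\<close>. As \<open>P\<close> is additive, one of the two has infinite
  variation again. Iterating in that part removes disjoint sets with \<open>|\<sigma>| \<ge> 1\<close>, which contradicts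
  the convergence of the series of their values.
\<close>

lemma finite_measure_pos_variation:
  fixes \<sigma> :: "(real ^ 'd) set \<Rightarrow> real"
  assumes \<sigma>: "\<And>A :: nat \<Rightarrow> (real ^ 'd) set. range A \<subseteq> sets borel \<Longrightarrow> disjoint_family A \<Longrightarrow>
       (\<lambda>i. \<sigma> (A i)) sums \<sigma> (\<Union>i. A i)"
  shows "finite_measure (pos_variation \<sigma>)"
proof -
  define f where "f = (\<lambda>E. SUP A\<in>{A \<in> sets borel. A \<subseteq> E}. ennreal (\<sigma> A))"
  let ?P = "emeasure (pos_variation \<sigma>)"
  have P_eq: "pos_variation \<sigma> = measure_of UNIV (sets borel) f" by (simp add: pos_variation_def f_def)
  have sig: "sigma_sets UNIV (sets borel) = sets (borel :: (real ^ 'd) measure)"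
    using sets.sigma_sets_eq[of "borel :: (real ^ 'd) measure"] by simp
  have "?P UNIV \<noteq> \<infinity>"
  proof (cases "measure_space UNIV (sets (borel :: (real ^ 'd) measure)) f")
    \<comment> \<open>In this case \<open>pos_variation \<sigma>\<close> is the zero measure.\<close>
    case False
    then show ?thesis by (simp add: P_eq emeasure_measure_of_conv sig)
  next
    case True
    have P_f: "?P E = f E" if "E \<in> sets borel" for E
      using True that by (simp add: P_eq emeasure_measure_of_conv sig)
    have \<sigma>_empty: "\<sigma> {} = 0"
      using \<sigma>[of "\<lambda>_. {}"] by (auto simp: disjoint_family_on_def sums_iff summable_const_iff)
    have \<sigma>_Un: "\<sigma> (A \<union> B) = \<sigma> A + \<sigma> B" if "A \<in> sets borel" "B \<in> sets borel" "A \<inter> B = {}" for A B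
    proof -
      have "disjoint_family (binaryset A B)"
        using that(3) by (auto simp: disjoint_family_on_def binaryset_def)
      moreover have "range (binaryset A B) \<subseteq> sets borel" using that by (auto simp: range_binaryset_eq)
      ultimately have "(\<lambda>i. \<sigma> (binaryset A B i)) sums \<sigma> (A \<union> B)"
        using \<sigma>[of "binaryset A B"] by (simp add: UN_binaryset_eq)
      then show ?thesis using binaryset_sums[of \<sigma>, OF \<sigma>_empty] sums_unique2 by blast
    qed
    show ?thesis
    proof
      assume inf: "?P UNIV = \<infinity>"
      define Q where "Q = (\<lambda>E. E \<in> sets borel \<and> ?P E = \<infinity>)"
      have step: "\<exists>A. Q A \<and> A \<subseteq> E \<and> 1 \<le> \<bar>\<sigma> (E - A)\<bar>" if "Q E" for E
      proof -
        have E: "E \<in> sets borel" "?P E = \<infinity>" using that by (auto simp: Q_def)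
        have "ennreal (1 + \<bar>\<sigma> E\<bar>) < f E" using E P_f by simp
        then obtain B where B: "B \<in> sets borel" "B \<subseteq> E" "ennreal (1 + \<bar>\<sigma> E\<bar>) < ennreal (\<sigma> B)"
          unfolding f_def less_SUP_iff by auto
        from B(3) have big: "1 + \<bar>\<sigma> E\<bar> < \<sigma> B" by (subst (asm) ennreal_less_iff) auto
        have EB: "E - B \<in> sets borel" using E B by auto
        have "B \<union> (E - B) = E" using B by auto
        then have "\<sigma> E = \<sigma> B + \<sigma> (E - B)" using \<sigma>_Un[OF B(1) EB] by auto
        then have big': "1 \<le> \<bar>\<sigma> (E - B)\<bar>" using big by linarith
        have "?P E = ?P B + ?P (E - B)"
          using plus_emeasure[of B "pos_variation \<sigma>" "E - B"] B EB \<open>B \<union> (E - B) = E\<close> by auto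
        then consider "?P B = \<infinity>" | "?P (E - B) = \<infinity>" using E(2) by (metis ennreal_add_eq_top infinity_ennreal_def)
        then show ?thesis
        proof cases
          case 1
          then show ?thesis using B big' by (intro exI[of _ B]) (auto simp: Q_def)
        next
          case 2
          have "E - (E - B) = B" using B by auto
          then show ?thesis using 2 EB big by (intro exI[of _ "E - B"]) (auto simp: Q_def)
        qed
      qed
      have "Q UNIV" using inf by (simp add: Q_def)
      then obtain E where E: "\<And>n. Q (E n)" "\<And>n. E (Suc n) \<subseteq> E n" "\<And>n. 1 \<le> \<bar>\<sigma> (E n - E (Suc n))\<bar>"
        using dependent_nat_choice[of "\<lambda>_. Q" "\<lambda>_ E A. A \<subseteq> E \<and> 1 \<le> \<bar>\<sigma> (E - A)\<bar>"] step by metis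
      have anti: "E n \<subseteq> E m" if "m \<le> n" for m n
        using that E(2) by (rule lift_Suc_antimono_le[rotated])
      have "disjoint_family (\<lambda>n. E n - E (Suc n))"
      unfolding disjoint_family_on_def
      proof (intro ballI impI)
        fix m n :: nat assume "m \<noteq> n"
        then consider "Suc m \<le> n" | "Suc n \<le> m" by linarith
        then show "(E m - E (Suc m)) \<inter> (E n - E (Suc n)) = {}"
          using anti[of "Suc m" n] anti[of "Suc n" m] by cases auto
      qed
      then have "(\<lambda>n. \<sigma> (E n - E (Suc n))) sums \<sigma> (\<Union>n. E n - E (Suc n))"
        using E(1) by (intro \<sigma>) (auto simp: Q_def)
      then have "(\<lambda>n. \<sigma> (E n - E (Suc n))) \<longlonglongrightarrow> 0"
        by (intro summable_LIMSEQ_zero sums_summable)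
      then have "eventually (\<lambda>n. \<bar>\<sigma> (E n - E (Suc n))\<bar> < 1) sequentially"
        using tendstoD[of "\<lambda>n. \<sigma> (E n - E (Suc n))" 0 sequentially 1] by (simp add: dist_real_def)
      then show False using E(3) by (auto simp: eventually_sequentially not_less[symmetric])
    qed
  qed
  then show ?thesis
    by (intro finite_measureI) (simp add: P_eq space_measure_of_conv)
qed

lemma complex_measure_integral_add:
  fixes \<nu> :: "(real ^ 'd) set \<Rightarrow> complex"
  assumes \<nu>: "complex_borel_measure \<nu>"
    and f: "f \<in> borel_measurable borel" "\<And>x. norm (f x) \<le> Bf"
    and g: "g \<in> borel_measurable borel" "\<And>x. norm (g x) \<le> Bg"
  shows "complex_measure_integral \<nu> (\<lambda>x. f x + g x) = complex_measure_integral \<nu> f + complex_measure_integral \<nu> g"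
proof -
  have split: "(LINT x|pos_variation \<sigma>. f x + g x) = (LINT x|pos_variation \<sigma>. f x) + (LINT x|pos_variation \<sigma>. g x)"
    if \<sigma>: "\<And>A :: nat \<Rightarrow> (real ^ 'd) set. range A \<subseteq> sets borel \<Longrightarrow> disjoint_family A \<Longrightarrow>
       (\<lambda>i. \<sigma> (A i)) sums \<sigma> (\<Union>i. A i)" for \<sigma>
  proof -
    interpret finite_measure "pos_variation \<sigma>" by (rule finite_measure_pos_variation) (rule \<sigma>)
    have int: "integrable (pos_variation \<sigma>) h" if "h \<in> borel_measurable borel" "\<And>x. norm (h x) \<le> B"
      for h :: "real ^ 'd \<Rightarrow> complex" and B
    proof (rule integrable_const_bound)
      show "AE x in pos_variation \<sigma>. norm (h x) \<le> B" using that(2) by simp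
      show "h \<in> borel_measurable (pos_variation \<sigma>)"
        using that(1) measurable_cong_sets[OF sets_pos_variation refl] by blast
    qed
    show ?thesis by (rule Bochner_Integration.integral_add[OF int[OF f] int[OF g]])
  qed
  have \<nu>': "(\<lambda>i. \<nu> (A i)) sums \<nu> (\<Union>i. A i)" if "range A \<subseteq> sets borel" "disjoint_family A"
    for A :: "nat \<Rightarrow> (real ^ 'd) set"
    using \<nu> that unfolding complex_borel_measure_def by blast
  have eqs: "(LINT x|pos_variation \<sigma>. f x + g x) = (LINT x|pos_variation \<sigma>. f x) + (LINT x|pos_variation \<sigma>. g x)"
    if "\<sigma> \<in> {\<lambda>A. Re (\<nu> A), \<lambda>A. - Re (\<nu> A), \<lambda>A. Im (\<nu> A), \<lambda>A. - Im (\<nu> A)}" for \<sigma>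
    by (rule split) (use that \<nu>' in \<open>auto intro!: sums_minus sums_Re sums_Im\<close>)
  show ?thesis unfolding complex_measure_integral_def
    by (simp add: eqs algebra_simps)
qed

section \<open>Samples of null sequences\<close>

text \<open>
  The set where the modulus exceeds its essential supremum is open and null, hence empty.
\<close>

lemma continuous_le_esssup:
  fixes g :: "real ^ 'd \<Rightarrow> complex"
  assumes g: "continuous_on UNIV g" and fin: "esssup lborel (\<lambda>x. ennreal (norm (g x))) < \<infinity>"
  shows "norm (g x) \<le> Lp_norm \<infinity> g"
proof -
  let ?M = "Lp_norm \<infinity> g"
  have "AE x in lborel. ennreal (norm (g x)) \<le> ennreal ?M"
    using esssup_AE[of "\<lambda>x. ennreal (norm (g x))" lborel] fin by (simp add: Lp_norm_def)
  then have ae: "AE x in lborel. norm (g x) \<le> ?M"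
    by eventually_elim (simp add: Lp_norm_def)
  have op: "open {x. ?M < norm (g x)}"
    by (intro open_Collect_less continuous_intros g)
  have "{x \<in> space lborel. \<not> norm (g x) \<le> ?M} \<in> null_sets lborel"
    using ae op by (subst AE_iff_null[symmetric]) (auto simp: not_le)
  then have "negligible {x. ?M < norm (g x)}"
    unfolding negligible_iff_null_sets by (auto simp: not_le intro: null_sets_completionI)
  then have "{x. ?M < norm (g x)} = {}" using open_not_negligible[OF op] by blast
  then show ?thesis by (auto simp: not_less[symmetric])
qed

text \<open>
  Test the upper \<open>L\<^sup>\<infinity>\<close> bound on the finitely supported coefficients that align the phases of the
  generators at a given point: the value of the synthesized function there is the sum of the moduli,
  and continuity turns the essential supremum into a bound at every point.
\<close>

lemma generator_sum_bound:
  fixes \<Phi> :: "int ^ 'd \<Rightarrow> real ^ 'd \<Rightarrow> complex"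
  assumes cont: "\<And>k. continuous_on UNIV (\<Phi> k)" and gen: "p_stable_generator \<infinity> \<Phi>"
  obtains M where "0 < M" "\<And>x F. finite F \<Longrightarrow> (\<Sum>k\<in>F. norm (\<Phi> k x)) \<le> M"
    "\<And>c. c \<in> lp_space \<infinity> \<Longrightarrow> Lp_norm \<infinity> (synthesis \<Phi> c) \<le> M * lp_norm \<infinity> c"
proof -
  obtain M where M: "0 < M" and space: "\<And>c. c \<in> lp_space \<infinity> \<Longrightarrow> synthesis \<Phi> c \<in> Lp_space \<infinity>"
    and upper: "\<And>c. c \<in> lp_space \<infinity> \<Longrightarrow> Lp_norm \<infinity> (synthesis \<Phi> c) \<le> M * lp_norm \<infinity> c"
    using gen unfolding p_stable_generator_def by blast
  have "(\<Sum>k\<in>F. norm (\<Phi> k x0)) \<le> M" if F: "finite F" for x0 F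
  proof -
    define c where "c = (\<lambda>k. if k \<in> F then cnj (sgn (\<Phi> k x0)) else 0)"
    have "norm (c k) \<le> 1" for k by (simp add: c_def norm_sgn)
    from sup_norm_le[OF this] have c: "c \<in> lp_space \<infinity>" "lp_norm \<infinity> c \<le> 1" .
    have syn: "synthesis \<Phi> c = (\<lambda>x. \<Sum>k\<in>F. c k * \<Phi> k x)"
    proof
      fix x
      have "synthesis \<Phi> c x = (\<Sum>\<^sub>\<infinity>k\<in>F. c k * \<Phi> k x)"
        unfolding synthesis_def by (rule infsum_cong_neutral) (auto simp: c_def)
      then show "synthesis \<Phi> c x = (\<Sum>k\<in>F. c k * \<Phi> k x)" using F by simp
    qed
    have "c k * \<Phi> k x0 = of_real (norm (\<Phi> k x0))" if "k \<in> F" for k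
    proof -
      have "c k * \<Phi> k x0 = \<Phi> k x0 * cnj (\<Phi> k x0) / of_real (norm (\<Phi> k x0))"
        using that by (simp add: c_def sgn_div_norm scaleR_conv_of_real field_simps)
      also have "\<dots> = of_real (norm (\<Phi> k x0))"
        by (simp add: complex_norm_square[symmetric] power2_eq_square)
      finally show ?thesis .
    qed
    then have "synthesis \<Phi> c x0 = of_real (\<Sum>k\<in>F. norm (\<Phi> k x0))" by (simp add: syn)
    then have "norm (synthesis \<Phi> c x0) = (\<Sum>k\<in>F. norm (\<Phi> k x0))" by (simp add: sum_nonneg del: of_real_sum)
    moreover have "norm (synthesis \<Phi> c x0) \<le> Lp_norm \<infinity> (synthesis \<Phi> c)"
    proof (rule continuous_le_esssup)
      show "continuous_on UNIV (synthesis \<Phi> c)"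
        unfolding syn by (intro continuous_intros cont)
      show "esssup lborel (\<lambda>x. ennreal (norm (synthesis \<Phi> c x))) < \<infinity>"
        using space[OF c(1)] by (simp add: Lp_space_def)
    qed
    ultimately show ?thesis using upper[OF c(1)] mult_left_mono[OF c(2), of M] M by linarith
  qed
  then show ?thesis using that M upper by blast
qed

text \<open>
  By density of the finitely supported sequences in \<open>c\<^sub>0\<close>: the synthesized function splits accordingly,
  finitely supported coefficients lie in \<open>\<ell>\<^sup>1\<close> and give samples in \<open>\<ell>\<^sup>1\<close>, and small coefficients give
  small samples by the bound for the exponent \<open>\<infinity>\<close>.
\<close>

lemma sampler_zero:
  fixes \<Phi> :: "int ^ 'd \<Rightarrow> real ^ 'd \<Rightarrow> complex"
  assumes cont: "\<And>k. continuous_on UNIV (\<Phi> k)" and gen: "p_stable_generator \<infinity> \<Phi>"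
    and \<mu>: "\<And>j. complex_borel_measure (\<mu> j)"
    and samp1: "sampler \<Phi> 1 \<mu>" and samp: "sampler \<Phi> \<infinity> \<mu>"
  shows "sampler \<Phi> 0 \<mu>"
proof -
  obtain M where M: "0 < M" "\<And>x F. finite F \<Longrightarrow> (\<Sum>k\<in>F. norm (\<Phi> k x)) \<le> M"
    "\<And>c. c \<in> lp_space \<infinity> \<Longrightarrow> Lp_norm \<infinity> (synthesis \<Phi> c) \<le> M * lp_norm \<infinity> c"
    using generator_sum_bound[OF cont gen] by blast
  obtain C where C: "\<And>f. f \<in> V_space \<infinity> \<Phi> \<Longrightarrow> sample \<mu> f \<in> lp_space \<infinity> \<and>
      lp_norm \<infinity> (sample \<mu> f) \<le> C * Lp_norm \<infinity> f"
    using samp unfolding sampler_def by blast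
  have s\<Phi>: "(\<lambda>k. norm (\<Phi> k x)) summable_on UNIV" for x
    by (rule summable_on_of_bounded_sums(1)[of _ M]) (use M in auto)
  have syn_sum: "(\<lambda>k. norm (c k * \<Phi> k x)) summable_on UNIV"
    and syn_bound: "norm (synthesis \<Phi> c x) \<le> lp_norm \<infinity> c * (\<Sum>\<^sub>\<infinity>k. norm (\<Phi> k x))"
    if c: "c \<in> lp_space \<infinity>" for c x
  proof -
    have s1: "(\<lambda>k. lp_norm \<infinity> c * norm (\<Phi> k x)) summable_on UNIV" by (intro summable_on_cmult_right s\<Phi>)
    have le: "norm (c k * \<Phi> k x) \<le> lp_norm \<infinity> c * norm (\<Phi> k x)" for k
      unfolding norm_mult by (intro mult_right_mono norm_le_sup_norm c) auto
    show s2: "(\<lambda>k. norm (c k * \<Phi> k x)) summable_on UNIV"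
      by (rule summable_on_comparison_test[OF s1]) (use le in auto)
    have "norm (synthesis \<Phi> c x) \<le> (\<Sum>\<^sub>\<infinity>k. norm (c k * \<Phi> k x))"
      unfolding synthesis_def by (rule norm_infsum_bound[OF s2])
    also have "\<dots> \<le> (\<Sum>\<^sub>\<infinity>k. lp_norm \<infinity> c * norm (\<Phi> k x))" by (rule infsum_mono[OF s2 s1 le])
    also have "\<dots> = lp_norm \<infinity> c * (\<Sum>\<^sub>\<infinity>k. norm (\<Phi> k x))" by (intro infsum_cmult_right s\<Phi>)
    finally show "norm (synthesis \<Phi> c x) \<le> lp_norm \<infinity> c * (\<Sum>\<^sub>\<infinity>k. norm (\<Phi> k x))" .
  qed
  have syn_le: "norm (synthesis \<Phi> c x) \<le> \<bar>lp_norm \<infinity> c\<bar> * M" if "c \<in> lp_space \<infinity>" for c x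
  proof -
    have "(\<Sum>\<^sub>\<infinity>k. norm (\<Phi> k x)) \<le> M" by (rule infsum_le_finite_sums[OF s\<Phi> M(2)])
    then have "lp_norm \<infinity> c * (\<Sum>\<^sub>\<infinity>k. norm (\<Phi> k x)) \<le> \<bar>lp_norm \<infinity> c\<bar> * M"
      by (intro mult_mono infsum_nonneg) auto
    with syn_bound[OF that, of x] show ?thesis by linarith
  qed
  have syn_meas: "synthesis \<Phi> c \<in> borel_measurable borel" if "c \<in> lp_space \<infinity>" for c
    using gen that unfolding p_stable_generator_def Lp_space_def by auto
  have sample_add: "sample \<mu> (synthesis \<Phi> (\<lambda>k. a k + b k)) j
      = sample \<mu> (synthesis \<Phi> a) j + sample \<mu> (synthesis \<Phi> b) j"
    if a: "a \<in> lp_space \<infinity>" and b: "b \<in> lp_space \<infinity>" for a b j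
  proof -
    have "synthesis \<Phi> (\<lambda>k. a k + b k) = (\<lambda>x. synthesis \<Phi> a x + synthesis \<Phi> b x)"
      unfolding synthesis_def distrib_right
      by (rule ext, rule infsum_add[OF abs_summable_summable[OF syn_sum[OF a]]
          abs_summable_summable[OF syn_sum[OF b]]])
    then show ?thesis unfolding sample_def
      using complex_measure_integral_add[OF \<mu> syn_meas[OF a] syn_le[OF a] syn_meas[OF b] syn_le[OF b]]
      by simp
  qed
  have null: "sample \<mu> (synthesis \<Phi> c) \<in> lp_space 0" if c: "c \<in> lp_space 0" for c
  proof -
    have "eventually (\<lambda>j. dist (sample \<mu> (synthesis \<Phi> c) j) 0 < e) cofinite" if e: "e > 0" for e
    proof -
      \<comment> \<open>The threshold that separates large from small coefficients; adding \<open>1\<close> avoids division by zero.\<close>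
      define \<eta> where "\<eta> = e / (2 * (\<bar>C\<bar> * M + 1))"
      have CM: "0 \<le> \<bar>C\<bar> * M" using M(1) by simp
      have \<eta>: "0 < \<eta>" using e CM by (simp add: \<eta>_def)
      have "\<bar>C\<bar> * M * \<eta> \<le> (\<bar>C\<bar> * M + 1) * \<eta>" using \<eta> by (simp add: algebra_simps)
      also have "\<dots> = e / 2" using CM by (simp add: \<eta>_def field_simps)
      finally have \<eta>_small: "\<bar>C\<bar> * M * \<eta> \<le> e / 2" .
      define a where "a = (\<lambda>k. if norm (c k) < \<eta> then 0 else c k)"
      define b where "b = (\<lambda>k. if norm (c k) < \<eta> then c k else 0)"
      have ab: "c = (\<lambda>k. a k + b k)" by (auto simp: a_def b_def)
      have "(c \<longlongrightarrow> 0) cofinite" using c by (simp add: lp_space_def)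
      from tendstoD[OF this \<eta>] have "finite {k. \<not> norm (c k) < \<eta>}" by (simp add: eventually_cofinite)
      then have fin: "finite {k. norm (a k) \<noteq> 0}" by (rule rev_finite_subset) (auto simp: a_def)
      have a_sum: "(\<lambda>k. norm (a k)) summable_on UNIV"
        by (rule finite_nonzero_values_imp_summable_on) (use fin in simp)
      have a: "a \<in> lp_space 1" "a \<in> lp_space \<infinity>" by (intro summable_imp_lp_space[OF _ a_sum]; simp)+
      have b: "b \<in> lp_space \<infinity>" "lp_norm \<infinity> b \<le> \<eta>"
        using sup_norm_le[of b \<eta>] \<eta> by (auto simp: b_def)
      have "sample \<mu> (synthesis \<Phi> a) \<in> lp_space 1"
        using samp1 a(1) unfolding sampler_def V_space_def by blast
      then have "sample \<mu> (synthesis \<Phi> a) \<in> lp_space 0"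
        by (intro summable_imp_null_sequence) (simp add: lp_space_def)
      then have "(sample \<mu> (synthesis \<Phi> a) \<longlongrightarrow> 0) cofinite" by (simp add: lp_space_def)
      from tendstoD[OF this, of "e / 2"] e
      have ev: "eventually (\<lambda>j. norm (sample \<mu> (synthesis \<Phi> a) j) < e / 2) cofinite" by simp
      have Vb: "synthesis \<Phi> b \<in> V_space \<infinity> \<Phi>" using b(1) by (auto simp: V_space_def)
      have b_small: "norm (sample \<mu> (synthesis \<Phi> b) j) \<le> e / 2" for j
      proof -
        have "norm (sample \<mu> (synthesis \<Phi> b) j) \<le> lp_norm \<infinity> (sample \<mu> (synthesis \<Phi> b))"
          using C[OF Vb] norm_le_sup_norm by blast
        also have "\<dots> \<le> C * Lp_norm \<infinity> (synthesis \<Phi> b)" using C[OF Vb] by blast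
        also have "\<dots> \<le> \<bar>C\<bar> * (M * \<eta>)"
        proof (rule mult_mono)
          show "Lp_norm \<infinity> (synthesis \<Phi> b) \<le> M * \<eta>"
            using M(3)[OF b(1)] mult_left_mono[OF b(2), of M] M(1) by linarith
        qed (auto simp: Lp_norm_def)
        finally show ?thesis using \<eta>_small by (simp add: mult.assoc)
      qed
      show ?thesis using ev
      proof eventually_elim
        case (elim j)
        have "sample \<mu> (synthesis \<Phi> c) j = sample \<mu> (synthesis \<Phi> a) j + sample \<mu> (synthesis \<Phi> b) j"
          using sample_add[OF a(2) b(1)] ab by simp
        then show ?case
          using elim b_small[of j] norm_triangle_ineq[of "sample \<mu> (synthesis \<Phi> a) j" "sample \<mu> (synthesis \<Phi> b) j"]
          by simp
      qed
    qed
    then have "(sample \<mu> (synthesis \<Phi> c) \<longlongrightarrow> 0) cofinite" by (rule tendstoI)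
    then show ?thesis by (simp add: lp_space_def)
  qed
  have "V_space 0 \<Phi> \<subseteq> V_space \<infinity> \<Phi>"
    using lp_space_subset_bounded[of 0] by (auto simp: V_space_def exponents_def)
  then show ?thesis
    unfolding sampler_def lp_norm_0 Lp_norm_0
    using C null by (intro exI[of _ C] ballI) (auto simp: V_space_def)
qed

section \<open>Stability for all exponents\<close>

theorem theorem3p2:
  fixes \<Phi> :: "int ^ 'd \<Rightarrow> real ^ 'd \<Rightarrow> complex"
    and \<mu> :: "int ^ 'd \<Rightarrow> (real ^ 'd) set \<Rightarrow> complex"
    and s \<alpha> :: real
  assumes "s > (real CARD('d) + 1)\<^sup>2"
    and "\<And>k. continuous_on UNIV (\<Phi> k)"
    and "\<And>k. \<Phi> k \<in> W1_space (poly_weight s)"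
    and "\<And>q. q \<in> exponents \<Longrightarrow> p_stable_generator q \<Phi>"
    and "\<And>j. complex_borel_measure (\<mu> j)"
    and "\<And>p. 1 \<le> p \<Longrightarrow> sampler \<Phi> p \<mu>"
    and "\<And>p. p \<in> exponents \<Longrightarrow> lp_bounded p (sampling_matrix \<Phi> \<mu>)"
    and "\<exists>p\<in>exponents. lp_bounded_below p (sampling_matrix \<Phi> \<mu>)"
    and "\<alpha> \<noteq> 0"
    and "sampling_matrix \<Phi> \<mu> \<in> slanted_matrices \<alpha> (poly_weight s)"
  shows "\<forall>q\<in>exponents. stable_sampler \<Phi> q \<mu>"
proof
  fix q :: ennreal assume q: "q \<in> exponents"
  obtain p where p: "p \<in> exponents" "lp_bounded_below p (sampling_matrix \<Phi> \<mu>)" using assms(8) by blast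
  have "sampler \<Phi> q \<mu>"
  proof (cases "q = 0")
    case True
    then show ?thesis
      using sampler_zero[OF assms(2) assms(4) assms(5) assms(6) assms(6)] by (simp add: exponents_def)
  next
    case False
    then show ?thesis using q assms(6) by (auto simp: exponents_def)
  qed
  moreover have "lp_bounded_below q (sampling_matrix \<Phi> \<mu>)"
    by (rule slanted_bounded_below_transfer[OF four_mult_dim_le[OF assms(1)] assms(9,10)
          assms(7)[OF q] p q])
  ultimately show "stable_sampler \<Phi> q \<mu>"
    using assms(7)[OF q] by (simp add: stable_sampler_def)
qed

end
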